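(* Let $Q=\mathrm{diag}(q_1,\dots,q_n)$, $q_i>0$. Let the demand be generated by \[ \dot\sigma_1=0,\qquad \dot\sigma_2=S_2\sigma_2,\qquad P^l=\Pi_1\sigma_1+Q^{-1}\mathbf{1}_nR_2\sigma_2, \] where $\Pi_1$ is a diagonal matrix, $S_2\in\mathbb{R}^{p\times p}$ is skew-symmetric with purely imaginary eigenvalues ($0$ not in its spectrum), $R_2\in\mathbb{R}^{1\times p}$, and $(R_2,S_2)$ is observable. Let $\overline u(t)=Q^{-1}\frac{\mathbf{1}_n\mathbf{1}_n^TP^l(t)}{\mathbf{1}_n^TQ^{-1}\mathbf{1}_n}$. Suppose there exist constant $\overline\eta\in\mathcal{R}(D^T)\cap(-\frac{\pi}{2},\frac{\pi}{2})^m$, $\overline V\in\mathbb{R}^n_{>0}$ with $\overline u(t)-P^l(t)=D\Gamma(\overline V)\boldsymbol{\sin}(\overline\eta)$ for all $t$ and $E(\overline\eta)\overline V=\overline E_{fd}$, and that $(\overline\eta,\overline V)$ satisfies condition $(\ast)$. Let $\mathcal{G}^{comm}$ be a connected undirected communication graph on $\{1,\dots,n\}$ with neighbour sets $\mathcal{N}_i^{comm}$. Consider the network dynamics in closed loop with the controllers ($\theta_{1i}\in\mathbb{R}$, $\theta_{2i}\in\mathbb{R}^p$) \[ \dot\theta_{1i}=\sum_{j\in\mathcal{N}_i^{comm}}(\theta_{1j}-\theta_{1i})-q_i^{-1}\omega_i,\quad \dot\theta_{2i}=S_2\theta_{2i}-q_i^{-1}R_2^T\omega_i,\quad u_i=q_i^{-1}\theta_{1i}+q_i^{-1}R_2\theta_{2i}.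 \] Let $\overline\theta_1=\frac{\mathbf{1}_n\mathbf{1}_n^T\Pi_1\sigma_1}{\mathbf{1}_n^TQ^{-1}\mathbf{1}_n}$ and $\overline\theta_2(t)=\mathbf{1}_n\otimes\sigma_2(t)$. Then closed-loop solutions starting in a neighbourhood of $(\overline\eta,\mathbf{0},\overline V,\overline\theta_1,\overline\theta_2)$ converge asymptotically to the largest invariant set on which $\omega=\mathbf{0}$, $E(\eta)V-\overline E_{fd}=\mathbf{0}$, $\theta_1=\overline\theta_1$, $\theta_2=\overline\theta_2$; in particular the frequency deviation converges to zero and $u(t)-\overline u(t)\to\mathbf{0}$, $\overline u$ being the optimal (cost-minimizing) time-varying feedforward generation.
   Context: Standing setup (power network model). $\mathcal{G}=(\mathcal{V},\mathcal{E})$ is a connected undirected graph with node set $\{1,\dots,n\}$ and $m$ edges; each edge $k=\{i,j\}$ is given an arbitrary orientation, and $D\in\mathbb{R}^{n\times m}$ is the incidence matrix: $d_{ik}=+1$ if $i$ is the positive end of edge $k$, $-1$ if $i$ is the negative end, $0$ otherwise. $|D|$ denotes the matrix of entrywise absolute values of $D$. $\mathbf{1}_n$ is the all-ones vector. For each edge $k=\{i,j\}$ there is a susceptance $B_{ij}=B_{ji}>0$; each node has a self-susceptance $B_{ii}<0$ with $|B_{ii}|>\sum_{j\in\mathcal{N}_i}|B_{ij}|$ ($\mathcal{N}_i$ the neighbours of $i$ in $\mathcal{G}$), and reactances $X_{di}>X'_{di}>0$. For $V\in\mathbb{R}^n$, $\Gamma(V)=\mathrm{diag}(\gamma_1,\dots,\gamma_m)$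 with $\gamma_k=V_iV_jB_{ij}$ for edge $k=\{i,j\}$. For $\eta\in\mathbb{R}^m$, $E(\eta)\in\mathbb{R}^{n\times n}$ is the symmetric matrix with $E_{ii}=\frac{1-B_{ii}(X_{di}-X'_{di})}{X_{di}-X'_{di}}$, $E_{ij}=-B_{ij}\cos(\eta_k)$ if $k=\{i,j\}$ is an edge, and $E_{ij}=0$ otherwise. $\boldsymbol{\sin}$, $\boldsymbol{\cos}$ act componentwise. $M,A,T$ are diagonal positive definite $n\times n$ matrices ($A=\mathrm{diag}(A_i)$), and $\overline E_{fd}\in\mathbb{R}^n$ is a constant vector. The network dynamics, with input $u\in\mathbb{R}^n$ (power generation) and demand $P^l$, are \[ \dot\eta=D^T\omega,\quad M\dot\omega=u-D\Gamma(V)\boldsymbol{\sin}(\eta)-A\omega-P^l,\quad T\dot V=-E(\eta)V+\overline E_{fd},\quad y=\omega, \] with state $(\eta,\omega,V)\in\mathbb{R}^m\times\mathbb{R}^n\times\mathbb{R}^n$. Condition $(\ast)$ on $(\overline\eta,\overline V)$: \[ E(\overline\eta)-\mathrm{diag}(\overline V)^{-1}|D|\Gamma(\overline V)\mathrm{diag}(\boldsymbol{\sin}(\overline\eta))\mathrm{diag}(\boldsymbol{\cos}(\overline\eta))^{-1}\mathrm{diag}(\boldsymbol{\sin}(\overline\eta))|D|^T\mathrm{diag}(\overline V)^{-1}>0. \] *)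

theory Defs
  imports "HOL-Analysis.Analysis"
begin

text \<open>Network graph: nodes are the finite type 'n, edges the finite type 'm.
  Edge k is oriented from its positive end ep k to its negative end en k.\<close>

definition incidence :: "('m \<Rightarrow> 'n) \<Rightarrow> ('m \<Rightarrow> 'n) \<Rightarrow> real^'m^'n" where
  "incidence ep en = (\<chi> i k. if i = ep k then 1 else if i = en k then -1 else 0)"

definition absmat :: "real^'b^'a \<Rightarrow> real^'b^'a" where
  "absmat X = (\<chi> i j. \<bar>X $ i $ j\<bar>)"

definition diagm :: "real^'a \<Rightarrow> real^'a^'a" where
  "diagm v = (\<chi> i j. if i = j then v $ i else 0)"

definition vsin :: "real^'a \<Rightarrow> real^'a" where
  "vsin v = (\<chi> k. sin (v $ k))"

definition vcos :: "real^'a \<Rightarrow> real^'a" where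
  "vcos v = (\<chi> k. cos (v $ k))"

definition vinv :: "real^'a \<Rightarrow> real^'a" where
  "vinv v = (\<chi> k. 1 / (v $ k))"

text \<open>Simple connected undirected graph given by an oriented edge list.\<close>
definition simple_connected_graph :: "('m::finite \<Rightarrow> 'n::finite) \<Rightarrow> ('m \<Rightarrow> 'n) \<Rightarrow> bool" where
  "simple_connected_graph ep en \<longleftrightarrow>
     (\<forall>k. ep k \<noteq> en k) \<and>
     (\<forall>k l. {ep k, en k} = {ep l, en l} \<longrightarrow> k = l) \<and>
     (\<forall>i j. (\<lambda>a b. \<exists>k. {a, b} = {ep k, en k})\<^sup>*\<^sup>* i j)"

text \<open>Connected undirected (simple) communication graph as a symmetric irreflexive relation.\<close>
definition connected_undirected :: "('n \<Rightarrow> 'n \<Rightarrow> bool) \<Rightarrow> bool" where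
  "connected_undirected G \<longleftrightarrow> (\<forall>i. \<not> G i i) \<and> (\<forall>i j. G i j \<longleftrightarrow> G j i) \<and> (\<forall>i j. G\<^sup>*\<^sup>* i j)"

text \<open>Gamma(V) as the vector of its diagonal entries: gamma_k = V_i V_j B_ij.\<close>
definition Gam :: "('m \<Rightarrow> 'n) \<Rightarrow> ('m \<Rightarrow> 'n) \<Rightarrow> ('m \<Rightarrow> real) \<Rightarrow> real^'n \<Rightarrow> real^'m" where
  "Gam ep en B V = (\<chi> k. V $ ep k * V $ en k * B k)"

text \<open>The matrix E(eta). B k is the susceptance of edge k, Bs i the self-susceptance B_ii.\<close>
definition Emat :: "('m::finite \<Rightarrow> 'n) \<Rightarrow> ('m \<Rightarrow> 'n) \<Rightarrow> ('m \<Rightarrow> real) \<Rightarrow> ('n \<Rightarrow> real)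
     \<Rightarrow> ('n \<Rightarrow> real) \<Rightarrow> ('n \<Rightarrow> real) \<Rightarrow> real^'m \<Rightarrow> real^'n^'n" where
  "Emat ep en B Bs Xd Xdp eta = (\<chi> i j.
     if i = j then (1 - Bs i * (Xd i - Xdp i)) / (Xd i - Xdp i)
     else (\<Sum>k\<in>{k. {ep k, en k} = {i, j}}. - B k * cos (eta $ k)))"

definition posdef :: "real^'a^'a \<Rightarrow> bool" where
  "posdef X \<longleftrightarrow> transpose X = X \<and> (\<forall>x. x \<noteq> 0 \<longrightarrow> x \<bullet> (X *v x) > 0)"

text \<open>Condition (*).\<close>
definition cond_star :: "('m::finite \<Rightarrow> 'n::finite) \<Rightarrow> ('m \<Rightarrow> 'n) \<Rightarrow> ('m \<Rightarrow> real) \<Rightarrow> ('n \<Rightarrow> real)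
     \<Rightarrow> ('n \<Rightarrow> real) \<Rightarrow> ('n \<Rightarrow> real) \<Rightarrow> real^'m \<Rightarrow> real^'n \<Rightarrow> bool" where
  "cond_star ep en B Bs Xd Xdp eta V \<longleftrightarrow>
     posdef (Emat ep en B Bs Xd Xdp eta -
       diagm (vinv V) ** absmat (incidence ep en) ** diagm (Gam ep en B V) **
       diagm (vsin eta) ** diagm (vinv (vcos eta)) ** diagm (vsin eta) **
       transpose (absmat (incidence ep en)) ** diagm (vinv V))"

text \<open>Observability of (R2,S2): the observability matrix [R2; R2 S2; ...; R2 S2^(p-1)]
  has full column rank p, i.e. trivial kernel.\<close>
definition observable :: "real^'p \<Rightarrow> real^'p^'p \<Rightarrow> bool" where
  "observable R S \<longleftrightarrow>
     (\<forall>v. (\<forall>k < CARD('p). R \<bullet> ((((*v) S) ^^ k) v) = 0) \<longrightarrow> v = 0)"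

text \<open>Closed-loop state: ((eta, omega, V, theta1, theta2), sigma2), where theta2 $ i = theta_{2i}.\<close>
type_synonym ('m, 'n, 'p) clstate =
  "((real^'m) \<times> (real^'n) \<times> (real^'n) \<times> (real^'n) \<times> (real^'p^'n)) \<times> (real^'p)"

text \<open>Demand P^l = Pi1 sigma1 + Q^{-1} 1 R2 sigma2 (Pi1 = diag pi1, Q = diag q).\<close>
definition demand :: "('n \<Rightarrow> real) \<Rightarrow> ('n \<Rightarrow> real) \<Rightarrow> real^'n \<Rightarrow> real^'p \<Rightarrow> real^'p \<Rightarrow> real^'n" where
  "demand q pi1 s1 R s2 = (\<chi> i. pi1 i * s1 $ i + (R \<bullet> s2) / q i)"

text \<open>Controller output u_i = q_i^{-1} theta_{1i} + q_i^{-1} R2 theta_{2i}.\<close>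
definition ctrl_u :: "('n \<Rightarrow> real) \<Rightarrow> real^'p \<Rightarrow> real^'n \<Rightarrow> real^'p^'n \<Rightarrow> real^'n" where
  "ctrl_u q R th1 th2 = (\<chi> i. th1 $ i / q i + (R \<bullet> (th2 $ i)) / q i)"

text \<open>Optimal feedforward ubar = Q^{-1} 1 1^T P^l / (1^T Q^{-1} 1).\<close>
definition ubar :: "('n::finite \<Rightarrow> real) \<Rightarrow> real^'n \<Rightarrow> real^'n" where
  "ubar q Pl = (\<chi> i. (1 / q i) * (\<Sum>j\<in>UNIV. Pl $ j) / (\<Sum>j\<in>UNIV. 1 / q j))"

text \<open>theta1bar = 1 1^T Pi1 sigma1 / (1^T Q^{-1} 1).\<close>
definition theta1bar :: "('n::finite \<Rightarrow> real) \<Rightarrow> ('n \<Rightarrow> real) \<Rightarrow> real^'n \<Rightarrow> real^'n" where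
  "theta1bar q pi1 s1 = (\<chi> i. (\<Sum>j\<in>UNIV. pi1 j * s1 $ j) / (\<Sum>j\<in>UNIV. 1 / q j))"

text \<open>Closed-loop vector field (network + controllers + exosystem for sigma2; sigma1 constant).
  Mi, Ai, Ti are the diagonal entries of M, A, T.\<close>
definition clfield ::
  "('m::finite \<Rightarrow> 'n::finite) \<Rightarrow> ('m \<Rightarrow> 'n) \<Rightarrow> ('m \<Rightarrow> real) \<Rightarrow> ('n \<Rightarrow> real)
   \<Rightarrow> ('n \<Rightarrow> real) \<Rightarrow> ('n \<Rightarrow> real) \<Rightarrow> ('n \<Rightarrow> real) \<Rightarrow> ('n \<Rightarrow> real) \<Rightarrow> ('n \<Rightarrow> real)
   \<Rightarrow> real^'n \<Rightarrow> ('n \<Rightarrow> real) \<Rightarrow> ('n \<Rightarrow> real) \<Rightarrow> real^'n \<Rightarrow> real^'p::finite^'p \<Rightarrow> real^'p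
   \<Rightarrow> ('n \<Rightarrow> 'n \<Rightarrow> bool) \<Rightarrow> ('m, 'n, 'p) clstate \<Rightarrow> ('m, 'n, 'p) clstate" where
  "clfield ep en B Bs Xd Xdp Mi Ai Ti Efd q pi1 s1 S R Gc st =
    (let ((eta, w, V, th1, th2), s2) = st;
         D = incidence ep en;
         u = ctrl_u q R th1 th2;
         Pl = demand q pi1 s1 R s2;
         flow = D *v (\<chi> k. Gam ep en B V $ k * sin (eta $ k));
         EV = Emat ep en B Bs Xd Xdp eta *v V
     in ((transpose D *v w,
          (\<chi> i. (u $ i - flow $ i - Ai i * w $ i - Pl $ i) / Mi i),
          (\<chi> i. (- EV $ i + Efd $ i) / Ti i),
          (\<chi> i. (\<Sum>j\<in>{j. Gc i j}. th1 $ j - th1 $ i) - w $ i / q i),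
          (\<chi> i. S *v (th2 $ i) - (w $ i / q i) *\<^sub>R R)),
         S *v s2))"

text \<open>M is an invariant set of the autonomous ODE x' = f x: through every point of M
  there is a solution defined on all of the real line that remains in M.\<close>
definition invariant_set :: "('a::real_normed_vector \<Rightarrow> 'a) \<Rightarrow> 'a set \<Rightarrow> bool" where
  "invariant_set f M \<longleftrightarrow>
     (\<forall>x0\<in>M. \<exists>x. x 0 = x0 \<and> (\<forall>t. (x has_vector_derivative f (x t)) (at t)) \<and> (\<forall>t. x t \<in> M))"

definition largest_invariant_subset :: "('a::real_normed_vector \<Rightarrow> 'a) \<Rightarrow> 'a set \<Rightarrow> 'a set" where
  "largest_invariant_subset f \<Omega> = \<Union>{M. M \<subseteq> \<Omega> \<and> invariant_set f M}"

text \<open>x(t) converges to the set M as t \<rightarrow> \<infinity> (distance to M tends to 0; M nonempty implied).\<close>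
definition converges_to_set :: "(real \<Rightarrow> 'a::metric_space) \<Rightarrow> 'a set \<Rightarrow> bool" where
  "converges_to_set x M \<longleftrightarrow> (\<forall>e>0. \<forall>\<^sub>F t in at_top. \<exists>z\<in>M. dist (x t) z < e)"

end

theory Submission
  imports Defs
begin

text \<open>
  In the error coordinates the sum of the kinetic energy, the shifted network potential and
  \<open>(\<bar>\<theta>\<^sub>1 - \<theta>\<^sub>1bar\<bar>\<^sup>2 + \<bar>\<theta>\<^sub>2 - \<one> \<otimes> \<sigma>\<^sub>2\<bar>\<^sup>2) / 2\<close> decreases along solutions, its derivative being minus the
  damping, voltage and consensus dissipation; the skew-symmetric oscillators contribute nothing.
  Condition (*) is the Schur complement of the Hessian of the potential, so the operating point is a
  strict local minimum and solutions that start near it stay in a small ball.  Barbalat's lemma gives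
  that the dissipation tends to zero, and, applied again to the swing equation, that the power
  imbalance tends to zero.  Differentiating the imbalance repeatedly isolates the outputs
  \<open>R2 S2^(k+1) e\<close>, so that observability and the invertibility of \<open>S2\<close> force the oscillator errors to
  vanish; since line flows sum to zero over the nodes, the consensus value of
  \<open>\<theta>\<^sub>1 - \<theta>\<^sub>1bar\<close> vanishes in the limit as well.  The limiting equilibria, carried along by the
  exosystem, form an invariant set, which gives convergence to the largest one.
\<close>

subsection \<open>Limits and local minima\<close>

lemma nonincreasing_tendsto_at_top:
  fixes f :: "real \<Rightarrow> real"
  assumes anti: "\<And>s t. 0 \<le> s \<Longrightarrow> s \<le> t \<Longrightarrow> f t \<le> f s"
    and lower: "\<And>t. 0 \<le> t \<Longrightarrow> l \<le> f t"
  obtains L where "(f \<longlongrightarrow> L) at_top"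
proof
  let ?L = "Inf (f ` {0..})"
  have bdd: "bdd_below (f ` {0..})"
    using lower by (auto intro!: bdd_belowI)
  show "(f \<longlongrightarrow> ?L) at_top"
  proof (rule decreasing_tendsto)
    show "\<forall>\<^sub>F t in at_top. ?L \<le> f t"
      using eventually_ge_at_top[of 0] by eventually_elim (auto intro!: cInf_lower bdd)
  next
    fix y assume "?L < y"
    then obtain s where s: "0 \<le> s" "f s < y"
      using cInf_lessD[of "f ` {0..}" y] by auto
    show "\<forall>\<^sub>F t in at_top. f t < y"
      using eventually_ge_at_top[of s]
      by eventually_elim (use s anti in fastforce)
  qed
qed

text \<open>Increments of \<open>f\<close> over windows of a fixed length tend to zero, so the mean
  value theorem gives a point in each late window where \<open>a + b\<close> is small. There
  \<open>a\<close> is small too, and \<open>b\<close> hardly varies across the window. Splitting the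
  derivative allows a part already known to vanish to be discarded, and only \<open>b\<close> has to
  be uniformly continuous.\<close>

lemma barbalat:
  fixes f a b :: "real \<Rightarrow> real"
  assumes deriv: "\<And>t. 0 \<le> t \<Longrightarrow> (f has_real_derivative a t + b t) (at t within {0..})"
    and lim: "(f \<longlongrightarrow> L) at_top" and a: "(a \<longlongrightarrow> 0) at_top"
    and b: "uniformly_continuous_on {0..} b"
  shows "(b \<longlongrightarrow> 0) at_top"
proof (rule tendstoI)
  fix \<epsilon> :: real assume "0 < \<epsilon>"
  have "\<exists>\<delta>>0. \<forall>t\<in>{0..}. \<forall>s\<in>{0..}. dist s t < \<delta> \<longrightarrow> dist (b s) (b t) < \<epsilon> / 4"
    using b \<open>0 < \<epsilon>\<close> unfolding uniformly_continuous_on_def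
    by (elim allE[of _ "\<epsilon> / 4"]) simp
  then obtain \<delta> where "0 < \<delta>"
    and \<delta>: "\<forall>t\<in>{0..}. \<forall>s\<in>{0..}. dist s t < \<delta> \<longrightarrow> dist (b s) (b t) < \<epsilon> / 4"
    by blast
  obtain N where N: "\<And>t. N \<le> t \<Longrightarrow> \<bar>a t\<bar> < \<epsilon> / 4"
    using tendstoD[OF a, of "\<epsilon> / 4"] \<open>0 < \<epsilon>\<close> by (auto simp: eventually_at_top_linorder)
  have "((\<lambda>t. f (t + \<delta>) - f t) \<longlongrightarrow> L - L) at_top"
    using filterlim_tendsto_add_at_top[OF tendsto_const filterlim_ident, of \<delta>]
    by (intro tendsto_diff lim filterlim_compose[OF lim]) (simp add: add.commute)
  \<comment> \<open>Dividing by the window length leaves a quarter of \<epsilon> for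
    \<open>a + b\<close>; the bounds on \<open>a\<close> and on the variation of \<open>b\<close>
    add two more quarters.\<close>
  then have "\<forall>\<^sub>F t in at_top. dist (f (t + \<delta>) - f t) 0 < \<delta> * (\<epsilon> / 4)"
    using \<open>0 < \<delta>\<close> \<open>0 < \<epsilon>\<close> by (intro tendstoD) auto
  then show "\<forall>\<^sub>F t in at_top. dist (b t) 0 < \<epsilon>"
    using eventually_ge_at_top[of "max 0 N"]
  proof eventually_elim
    case (elim t)
    then have "0 \<le> t" "t < t + \<delta>" using \<open>0 < \<delta>\<close> by auto
    have "\<exists>\<xi>\<in>{t<..<t + \<delta>}. f (t + \<delta>) - f t = (t + \<delta> - t) * (a \<xi> + b \<xi>)"
    proof (rule mvt_simple[where f' = "\<lambda>s h. h * (a s + b s)", OF \<open>t < t + \<delta>\<close>])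
      fix s assume "t \<le> s" "s \<le> t + \<delta>"
      then have "(f has_real_derivative a s + b s) (at s within {t..t + \<delta>})"
        using deriv[of s] \<open>0 \<le> t\<close> by (auto intro: DERIV_subset)
      then show "(f has_derivative (\<lambda>h. h * (a s + b s))) (at s within {t..t + \<delta>})"
        by (simp add: has_field_derivative_def mult_commute_abs)
    qed
    then obtain \<xi> where \<xi>: "t < \<xi>" "\<xi> < t + \<delta>" and mvt: "f (t + \<delta>) - f t = \<delta> * (a \<xi> + b \<xi>)"
      by auto
    have "\<delta> * \<bar>a \<xi> + b \<xi>\<bar> < \<delta> * (\<epsilon> / 4)"
      using elim(1) \<open>0 < \<delta>\<close> by (simp add: mvt abs_mult)
    then have "\<bar>a \<xi> + b \<xi>\<bar> < \<epsilon> / 4" using \<open>0 < \<delta>\<close> by (simp only: mult_less_cancel_left_pos)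
    moreover have "\<bar>a \<xi>\<bar> < \<epsilon> / 4" using N[of \<xi>] \<xi> elim by simp
    moreover have "\<bar>b t - b \<xi>\<bar> < \<epsilon> / 4" using \<delta> \<xi> \<open>0 \<le> t\<close> by (simp add: dist_real_def)
    ultimately show ?case using \<open>0 < \<epsilon>\<close> unfolding dist_real_def by linarith
  qed
qed

text \<open>On the compact set where \<open>g\<close> has modulus at least \<epsilon>,
  \<open>f\<close> has no zero, so its modulus has a positive minimum there. Once \<open>f\<close>
  is below that minimum along the trajectory, \<open>g\<close> is below \<epsilon>. An implication
  between zeros thus becomes an implication between limits.\<close>

lemma compact_tendsto_zero_transfer:
  fixes z :: "real \<Rightarrow> 'a::metric_space" and f g :: "'a \<Rightarrow> real"
  assumes "compact K" and f: "continuous_on K f" and g: "continuous_on K g"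
    and K: "\<And>t. 0 \<le> t \<Longrightarrow> z t \<in> K"
    and lim: "((\<lambda>t. f (z t)) \<longlongrightarrow> 0) at_top"
    and zero: "\<And>y. y \<in> K \<Longrightarrow> f y = 0 \<Longrightarrow> g y = 0"
  shows "((\<lambda>t. g (z t)) \<longlongrightarrow> 0) at_top"
proof (rule tendstoI)
  fix \<epsilon> :: real assume "0 < \<epsilon>"
  let ?K = "{y \<in> K. \<epsilon> \<le> \<bar>g y\<bar>}"
  have "closedin (top_of_set K) ?K"
    using continuous_closedin_preimage[OF continuous_on_rabs[OF g] closed_atLeast[of \<epsilon>]]
    by (simp add: vimage_def Int_def)
  then have "compact ?K" using \<open>compact K\<close> closedin_compact by blast
  have cont: "continuous_on ?K (\<lambda>y. \<bar>f y\<bar>)"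
    by (intro continuous_on_rabs continuous_on_subset[OF f]) auto
  obtain m where m: "0 < m" "\<And>y. y \<in> ?K \<Longrightarrow> m \<le> \<bar>f y\<bar>"
  proof (cases "?K = {}")
    case True
    show thesis using True by (intro that[of 1]) (simp, blast)
  next
    case False
    obtain y0 where y0: "y0 \<in> ?K" "\<forall>y\<in>?K. \<bar>f y0\<bar> \<le> \<bar>f y\<bar>"
      using continuous_attains_inf[OF \<open>compact ?K\<close> False cont] by blast
    then have "f y0 \<noteq> 0" using \<open>0 < \<epsilon>\<close> zero by fastforce
    then show thesis using y0 by (intro that[of "\<bar>f y0\<bar>"]) (simp, blast)
  qed
  have "\<forall>\<^sub>F t in at_top. dist (f (z t)) 0 < m" using lim \<open>0 < m\<close> by (rule tendstoD)
  then show "\<forall>\<^sub>F t in at_top. dist (g (z t)) 0 < \<epsilon>" using eventually_ge_at_top[of 0]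
  proof eventually_elim
    case (elim t)
    then have "z t \<notin> ?K" using m(2)[of "z t"] by auto
    then show ?case using K[of t] elim by simp
  qed
qed

lemma uniformly_continuous_on_subset:
  fixes f :: "'a::metric_space \<Rightarrow> 'b::metric_space"
  shows "uniformly_continuous_on T f \<Longrightarrow> S \<subseteq> T \<Longrightarrow> uniformly_continuous_on S f"
  unfolding uniformly_continuous_on_def by (meson subsetD)

text \<open>By the intermediate value theorem, leaving the ball would mean crossing its sphere,
  where \<open>W\<close> is too large.\<close>

lemma confined_to_ball:
  fixes z :: "real \<Rightarrow> 'a::metric_space" and W :: "'a \<Rightarrow> real"
  assumes cont: "continuous_on {0..} z" and start: "dist c (z 0) < r"
    and sphere: "\<And>y. dist c y = r \<Longrightarrow> m \<le> W y"
    and below: "\<And>t. 0 \<le> t \<Longrightarrow> W (z t) < m" and "0 \<le> t"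
  shows "dist c (z t) < r"
proof (rule ccontr)
  assume "\<not> dist c (z t) < r"
  moreover have "continuous_on {0..t} (\<lambda>t. dist c (z t))"
    by (intro continuous_intros continuous_on_subset[OF cont]) auto
  ultimately obtain s where "0 \<le> s" "dist c (z s) = r"
    using IVT'[of "\<lambda>t. dist c (z t)" 0 r t] start \<open>0 \<le> t\<close> by auto
  then show False using sphere below by fastforce
qed

section \<open>Strict local minima from a positive second variation\<close>

lemma second_derivative_pos_imp_increase:
  fixes f f' f'' :: "real \<Rightarrow> real"
  assumes f: "\<And>s. 0 \<le> s \<Longrightarrow> s \<le> 1 \<Longrightarrow> (f has_real_derivative f' s) (at s)"
    and f': "\<And>s. 0 \<le> s \<Longrightarrow> s \<le> 1 \<Longrightarrow> (f' has_real_derivative f'' s) (at s)"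
    and "f' 0 = 0" and pos: "\<And>s. 0 \<le> s \<Longrightarrow> s \<le> 1 \<Longrightarrow> 0 < f'' s"
  shows "f 0 < f 1"
proof (rule DERIV_pos_imp_increasing_open[of 0 1 f])
  fix s :: real assume s: "0 < s" "s < 1"
  have "f' 0 < f' s"
  proof (rule DERIV_pos_imp_increasing[of 0 s f'])
    fix u assume "0 \<le> u" "u \<le> s"
    then show "\<exists>y. (f' has_real_derivative y) (at u) \<and> 0 < y"
      using f'[of u] pos[of u] s by auto
  qed (use s in simp)
  then show "\<exists>y. (f has_real_derivative y) (at s) \<and> 0 < y"
    using f[of s] s \<open>f' 0 = 0\<close> by auto
next
  show "continuous_on {0..1} f"
    by (rule DERIV_continuous_on[where D = f']) (rule has_field_derivative_at_within, rule f, auto)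
qed simp

text \<open>Positivity of the second variation at \<open>y\<close> on the compact unit sphere of
  directions spreads, by the tube lemma, to all base points near \<open>y\<close> uniformly in the
  direction. The one-dimensional criterion then applies on each segment from \<open>y\<close> to
  \<open>x\<close>.\<close>

lemma strict_local_min_of_pos_second_variation:
  fixes f :: "'a::euclidean_space \<Rightarrow> real" and df d2f :: "'a \<Rightarrow> 'a \<Rightarrow> real"
  assumes df: "\<And>z s. ((\<lambda>s. f (y + s *\<^sub>R z)) has_real_derivative df (y + s *\<^sub>R z) z) (at s)"
    and d2f: "\<And>z s. ((\<lambda>s. df (y + s *\<^sub>R z) z) has_real_derivative d2f (y + s *\<^sub>R z) z) (at s)"
    and crit: "\<And>z. df y z = 0"
    and cont: "continuous_on UNIV (\<lambda>(x, z). d2f x z)"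
    and hom: "\<And>x z c. d2f x (c *\<^sub>R z) = c\<^sup>2 * d2f x z"
    and pos: "\<And>z. z \<noteq> 0 \<Longrightarrow> 0 < d2f y z"
  obtains r where "0 < r" "\<And>x. x \<noteq> y \<Longrightarrow> dist y x < r \<Longrightarrow> f y < f x"
proof -
  let ?P = "{p. 0 < (\<lambda>(x, z). d2f x z) p}"
  have "open ?P" using cont by (intro open_Collect_less continuous_on_const)
  have "{y} \<times> sphere 0 1 \<subseteq> ?P" by (auto intro!: pos)
  obtain X where X: "y \<in> X" "open X" "X \<times> sphere 0 1 \<subseteq> ?P"
    using Elementary_Topology.tube_lemma[OF compact_sphere \<open>open ?P\<close> \<open>{y} \<times> sphere 0 1 \<subseteq> ?P\<close>] by metis
  then obtain r where "0 < r" and r: "ball y r \<subseteq> X" by (auto simp: open_contains_ball)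
  have "f y < f x" if "x \<noteq> y" "dist y x < r" for x
  proof -
    let ?z = "x - y"
    have "f (y + 0 *\<^sub>R ?z) < f (y + 1 *\<^sub>R ?z)"
    proof (rule second_derivative_pos_imp_increase[of "\<lambda>s. f (y + s *\<^sub>R ?z)"
          "\<lambda>s. df (y + s *\<^sub>R ?z) ?z" "\<lambda>s. d2f (y + s *\<^sub>R ?z) ?z"])
      fix s :: real assume "0 \<le> s" "s \<le> 1"
      then have "norm (s *\<^sub>R ?z) \<le> norm ?z" by (simp add: mult_left_le_one_le)
      then have "y + s *\<^sub>R ?z \<in> X"
        using r that(2) by (intro subsetD[OF r]) (simp add: dist_norm norm_minus_commute)
      \<comment> \<open>The tube covers unit directions only; homogeneity of degree two rescales to
        the actual displacement.\<close>
      then have "0 < d2f (y + s *\<^sub>R ?z) (?z /\<^sub>R norm ?z)"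
        using X(3) \<open>x \<noteq> y\<close> by (auto simp: subset_iff)
      then have "0 < d2f (y + s *\<^sub>R ?z) (norm ?z *\<^sub>R (?z /\<^sub>R norm ?z))"
        using \<open>x \<noteq> y\<close> by (subst hom) simp
      then show "0 < d2f (y + s *\<^sub>R ?z) ?z" using \<open>x \<noteq> y\<close> by simp
    qed (simp_all add: df d2f crit)
    then show ?thesis by simp
  qed
  then show thesis using that \<open>0 < r\<close> by blast
qed

subsection \<open>Network matrices\<close>

lemma diagm_mult [simp]: "diagm a *v x = (\<chi> i. a $ i * x $ i)"
  by (simp add: diagm_def matrix_vector_mult_def vec_eq_iff if_distrib[of "\<lambda>c. c * _"] cong: if_cong)

lemma inner_matrix_vector_mult:
  fixes A :: "real^'b::finite^'a::finite"
  shows "(A *v x) \<bullet> y = x \<bullet> (transpose A *v y)"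
  by (metis dot_lmul_matrix inner_commute transpose_matrix_vector)

lemma incidence_transpose_mult:
  assumes "ep k \<noteq> en k"
  shows "(transpose (incidence ep en) *v w) $ k = w $ ep k - w $ en k"
proof -
  have "(transpose (incidence ep en) *v w) $ k
      = (\<Sum>i\<in>UNIV. (if i = ep k then w $ i else 0) - (if i = en k then w $ i else 0))"
    using assms by (auto simp: matrix_vector_mult_def transpose_def incidence_def intro!: sum.cong)
  then show ?thesis by (simp add: sum_subtractf)
qed

lemma absmat_incidence_transpose_mult:
  assumes "ep k \<noteq> en k"
  shows "(transpose (absmat (incidence ep en)) *v w) $ k = w $ ep k + w $ en k"
proof -
  have "(transpose (absmat (incidence ep en)) *v w) $ k
      = (\<Sum>i\<in>UNIV. (if i = ep k then w $ i else 0) + (if i = en k then w $ i else 0))"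
    using assms
    by (auto simp: matrix_vector_mult_def transpose_def absmat_def incidence_def intro!: sum.cong)
  then show ?thesis by (simp add: sum.distrib)
qed

lemma incidence_mult_inner:
  assumes "\<And>k. ep k \<noteq> en k"
  shows "(incidence ep en *v y) \<bullet> w = (\<Sum>k\<in>UNIV. y $ k * (w $ ep k - w $ en k))"
  unfolding inner_matrix_vector_mult
  by (simp add: inner_vec_def incidence_transpose_mult[of ep _ en, OF assms] del: transpose_matrix_vector)

definition Ediag :: "('n \<Rightarrow> real) \<Rightarrow> ('n \<Rightarrow> real) \<Rightarrow> ('n \<Rightarrow> real) \<Rightarrow> 'n \<Rightarrow> real" where
  "Ediag Bs Xd Xdp i = (1 - Bs i * (Xd i - Xdp i)) / (Xd i - Xdp i)"

lemma Emat_mult: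
  assumes "\<And>k. ep k \<noteq> en k"
  shows "(Emat ep en B Bs Xd Xdp eta *v V) $ i
    = Ediag Bs Xd Xdp i * V $ i
      - (\<Sum>k\<in>UNIV. B k * cos (eta $ k) *
           ((if ep k = i then V $ en k else 0) + (if en k = i then V $ ep k else 0)))"
proof -
  let ?d = "Ediag Bs Xd Xdp i"
  have edge: "(\<Sum>j\<in>UNIV. if i \<noteq> j \<and> {ep k, en k} = {i, j} then - B k * cos (eta $ k) * V $ j else 0)
      = - (B k * cos (eta $ k) *
           ((if ep k = i then V $ en k else 0) + (if en k = i then V $ ep k else 0)))" for k
  proof -
    \<comment> \<open>An unordered pair can match the edge in two orientations. Absence of loops
      makes these exclusive and guarantees \<open>i \<noteq> j\<close>.\<close>
    have "(if i \<noteq> j \<and> {ep k, en k} = {i, j} then - B k * cos (eta $ k) * V $ j else 0)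
        = (if en k = j then if ep k = i then - B k * cos (eta $ k) * V $ j else 0 else 0)
          + (if ep k = j then if en k = i then - B k * cos (eta $ k) * V $ j else 0 else 0)" for j
      using assms[of k] by (auto simp: doubleton_eq_iff)
    then show ?thesis by (simp add: sum.distrib algebra_simps)
  qed
  have "(Emat ep en B Bs Xd Xdp eta *v V) $ i
      = (\<Sum>j\<in>UNIV. (if i = j then ?d * V $ j else 0)
          + (\<Sum>k\<in>UNIV. if i \<noteq> j \<and> {ep k, en k} = {i, j} then - B k * cos (eta $ k) * V $ j else 0))"
    unfolding matrix_vector_mult_def Emat_def Ediag_def[symmetric]
    by (auto intro!: sum.cong simp: sum_distrib_right sum.If_cases)
  also have "\<dots> = ?d * V $ i + (\<Sum>k\<in>UNIV. \<Sum>j\<in>UNIV.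
      if i \<noteq> j \<and> {ep k, en k} = {i, j} then - B k * cos (eta $ k) * V $ j else 0)"
    by (subst sum.swap) (simp add: sum.distrib)
  finally show ?thesis by (simp add: edge sum_negf del: minus_add_distrib)
qed

lemma Emat_mult_inner:
  assumes "\<And>k. ep k \<noteq> en k"
  shows "(Emat ep en B Bs Xd Xdp eta *v V) \<bullet> v
    = (\<Sum>i\<in>UNIV. Ediag Bs Xd Xdp i * (V $ i * v $ i))
      - (\<Sum>k\<in>UNIV. B k * cos (eta $ k) * (V $ en k * v $ ep k + V $ ep k * v $ en k))"
proof -
  have "(\<Sum>i\<in>UNIV. \<Sum>k\<in>UNIV. B k * cos (eta $ k) *
      ((if ep k = i then V $ en k else 0) + (if en k = i then V $ ep k else 0)) * v $ i)
    = (\<Sum>k\<in>UNIV. \<Sum>i\<in>UNIV. (if ep k = i then B k * cos (eta $ k) * V $ en k * v $ i else 0)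
        + (if en k = i then B k * cos (eta $ k) * V $ ep k * v $ i else 0))"
    by (subst sum.swap) (intro sum.cong refl, simp add: algebra_simps)
  also have "\<dots> = (\<Sum>k\<in>UNIV. B k * cos (eta $ k) * (V $ en k * v $ ep k + V $ ep k * v $ en k))"
    by (simp add: sum.distrib algebra_simps)
  finally show ?thesis
    by (simp add: inner_vec_def Emat_mult[of ep en, OF assms] left_diff_distrib sum_subtractf
        sum_distrib_right mult.assoc)
qed

section \<open>Quadratic forms of skew-symmetric matrices and of graph Laplacians\<close>

lemma skew_quadratic_form_eq_0:
  fixes S :: "real^'p::finite^'p"
  assumes "transpose S = - S"
  shows "v \<bullet> (S *v v) = 0"
proof -
  have "v \<bullet> (S *v v) = v \<bullet> (transpose S *v v)"
    by (metis inner_commute inner_matrix_vector_mult)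
  moreover have "transpose S *v v = - (S *v v)"
    by (simp add: assms matrix_vector_mult_def vec_eq_iff sum_negf)
  ultimately show ?thesis by simp
qed

text \<open>The double sum is averaged with its transpose, which symmetry of \<open>G\<close>
  permits. Each edge is counted in both directions, hence the factor one half.\<close>

lemma Laplacian_form:
  fixes p :: "real^'n::finite"
  assumes sym: "\<And>i j. G i j \<longleftrightarrow> G j i"
  shows "(\<Sum>i\<in>UNIV. p $ i * (\<Sum>j\<in>{j. G i j}. p $ j - p $ i))
    = - (\<Sum>i\<in>UNIV. \<Sum>j\<in>{j. G i j}. (p $ i - p $ j)\<^sup>2) / 2"
proof -
  define l where "l i j = (if G i j then p $ i * (p $ j - p $ i) else 0)" for i j
  have "(\<Sum>i\<in>UNIV. p $ i * (\<Sum>j\<in>{j. G i j}. p $ j - p $ i)) = (\<Sum>i\<in>UNIV. \<Sum>j\<in>UNIV. l i j)"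
    by (auto simp: l_def sum_distrib_left sum.If_cases intro!: sum.cong)
  moreover have "(\<Sum>i\<in>UNIV. \<Sum>j\<in>UNIV. l i j) = (\<Sum>i\<in>UNIV. \<Sum>j\<in>UNIV. l j i)"
    by (rule sum.swap)
  moreover have "(\<Sum>i\<in>UNIV. \<Sum>j\<in>UNIV. l i j) + (\<Sum>i\<in>UNIV. \<Sum>j\<in>UNIV. l j i)
      = (\<Sum>i\<in>UNIV. \<Sum>j\<in>UNIV. if G i j then - (p $ i - p $ j)\<^sup>2 else 0)"
    unfolding sum.distrib[symmetric]
    by (intro sum.cong refl) (auto simp: l_def sym power2_eq_square algebra_simps)
  moreover have "\<dots> = - (\<Sum>i\<in>UNIV. \<Sum>j\<in>{j. G i j}. (p $ i - p $ j)\<^sup>2)"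
    by (auto simp: sum.If_cases sum_negf intro!: sum.cong)
  ultimately show ?thesis by linarith
qed

lemma consensus_of_connected:
  assumes "connected_undirected G" and "\<And>i j. G i j \<Longrightarrow> p i = p j"
  shows "p i = p j"
proof -
  have "G\<^sup>*\<^sup>* i j" using assms(1) by (auto simp: connected_undirected_def)
  then show ?thesis by induction (use assms(2) in auto)
qed

subsection \<open>The network potential\<close>

locale controlled_network =
  fixes ep en :: "'m::finite \<Rightarrow> 'n::finite"
    and B :: "'m \<Rightarrow> real" and Bs Xd Xdp Mi Ai Ti q pi1 :: "'n \<Rightarrow> real"
    and Efd s1 :: "real^'n"
    and S2 :: "real^'p::finite^'p" and R2 :: "real^'p"
    and s2 :: "real \<Rightarrow> real^'p"
    and Gc :: "'n \<Rightarrow> 'n \<Rightarrow> bool"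
    and etabar :: "real^'m" and Vbar :: "real^'n"
  assumes graph: "simple_connected_graph ep en"
    and B_pos: "\<forall>k. B k > 0"
    and MAT_pos: "\<forall>i. Mi i > 0 \<and> Ai i > 0 \<and> Ti i > 0"
    and q_pos: "\<forall>i. q i > 0"
    and S2_skew: "transpose S2 = - S2"
    and S2_nonsing: "\<not> (\<exists>v. v \<noteq> 0 \<and> S2 *v v = 0)"
    and obs: "observable R2 S2"
    and exo: "\<forall>t. (s2 has_vector_derivative (S2 *v s2 t)) (at t)"
    and eta_box: "\<forall>k. - (pi / 2) < etabar $ k \<and> etabar $ k < pi / 2"
    and V_pos: "\<forall>i. Vbar $ i > 0"
    and equil_flow: "\<forall>t. ubar q (demand q pi1 s1 R2 (s2 t)) - demand q pi1 s1 R2 (s2 t)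
                        = incidence ep en *v (\<chi> k. Gam ep en B Vbar $ k * sin (etabar $ k))"
    and equil_volt: "Emat ep en B Bs Xd Xdp etabar *v Vbar = Efd"
    and star: "cond_star ep en B Bs Xd Xdp etabar Vbar"
    and comm: "connected_undirected Gc"
begin

lemma no_loop: "ep k \<noteq> en k"
  using graph by (simp add: simple_connected_graph_def)

abbreviation "F \<equiv> Ediag Bs Xd Xdp"

definition volt_err :: "real^'m \<Rightarrow> real^'n \<Rightarrow> real^'n" where
  "volt_err eta V = Emat ep en B Bs Xd Xdp eta *v V - Efd"

definition line_err :: "real^'m \<Rightarrow> real^'n \<Rightarrow> real^'m" where
  "line_err eta V = (\<chi> k. Gam ep en B V $ k * sin (eta $ k) - Gam ep en B Vbar $ k * sin (etabar $ k))"

definition flow_err :: "real^'m \<Rightarrow> real^'n \<Rightarrow> real^'n" where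
  "flow_err eta V = incidence ep en *v line_err eta V"

text \<open>Energy of lines and voltages, shifted by terms that are linear in the deviation so that
  the operating point becomes a critical point.\<close>
definition potential :: "real^'m \<Rightarrow> real^'n \<Rightarrow> real" where
  "potential eta V = (\<Sum>i\<in>UNIV. F i * (V $ i)\<^sup>2) / 2
     - (\<Sum>k\<in>UNIV. B k * V $ ep k * V $ en k * cos (eta $ k))
     - Efd \<bullet> V - (\<Sum>k\<in>UNIV. Gam ep en B Vbar $ k * sin (etabar $ k) * eta $ k)"

text \<open>This is the differential of \<open>potential\<close>: its gradient is
  \<open>line_err\<close> in the angles and \<open>volt_err\<close> in the voltages, the same errors
  that drive the swing and voltage equations.\<close>

definition potential_diff :: "real^'m \<Rightarrow> real^'n \<Rightarrow> real^'m \<Rightarrow> real^'n \<Rightarrow> real" where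
  "potential_diff eta V \<zeta> v = volt_err eta V \<bullet> v + line_err eta V \<bullet> \<zeta>"

definition potential_hess :: "real^'m \<Rightarrow> real^'n \<Rightarrow> real^'m \<Rightarrow> real^'n \<Rightarrow> real" where
  "potential_hess eta V \<zeta> v = (\<Sum>i\<in>UNIV. F i * (v $ i)\<^sup>2)
     + (\<Sum>k\<in>UNIV. B k * (V $ ep k * V $ en k * cos (eta $ k) * (\<zeta> $ k)\<^sup>2
         + 2 * sin (eta $ k) * \<zeta> $ k * (v $ ep k * V $ en k + v $ en k * V $ ep k)
         - 2 * cos (eta $ k) * v $ ep k * v $ en k))"

lemma potential_diff_eq:
  "potential_diff eta V \<zeta> v = (\<Sum>i\<in>UNIV. F i * V $ i * v $ i) - Efd \<bullet> v
     + (\<Sum>k\<in>UNIV. (B k * V $ ep k * V $ en k * sin (eta $ k)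
           - Gam ep en B Vbar $ k * sin (etabar $ k)) * \<zeta> $ k
         - B k * cos (eta $ k) * (V $ en k * v $ ep k + V $ ep k * v $ en k))"
proof -
  have "line_err eta V \<bullet> \<zeta> = (\<Sum>k\<in>UNIV. (B k * V $ ep k * V $ en k * sin (eta $ k)
           - Gam ep en B Vbar $ k * sin (etabar $ k)) * \<zeta> $ k)"
    by (simp add: line_err_def inner_vec_def Gam_def algebra_simps)
  then show ?thesis
    unfolding potential_diff_def volt_err_def inner_diff_left Emat_mult_inner[of ep en, OF no_loop]
    by (simp add: sum_subtractf mult.assoc)
qed

lemma potential_has_derivative:
  assumes eta: "\<And>k. ((\<lambda>t. eta t $ k) has_real_derivative eta' $ k) (at t within X)"
    and V: "\<And>i. ((\<lambda>t. V t $ i) has_real_derivative V' $ i) (at t within X)"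
  shows "((\<lambda>t. potential (eta t) (V t)) has_real_derivative potential_diff (eta t) (V t) eta' V')
    (at t within X)"
  unfolding potential_def inner_vec_def
  by (rule derivative_eq_intros eta V refl | simp)+
     (simp add: potential_diff_eq inner_vec_def sum_subtractf sum.distrib sum_divide_distrib
        power2_eq_square algebra_simps)

lemma potential_diff_has_derivative:
  assumes eta: "\<And>k. ((\<lambda>t. eta t $ k) has_real_derivative \<zeta> $ k) (at t within X)"
    and V: "\<And>i. ((\<lambda>t. V t $ i) has_real_derivative v $ i) (at t within X)"
  shows "((\<lambda>t. potential_diff (eta t) (V t) \<zeta> v) has_real_derivative
    potential_hess (eta t) (V t) \<zeta> v) (at t within X)"
  unfolding potential_diff_eq
  by (rule derivative_eq_intros eta V refl | simp)+
     (simp add: potential_hess_def power2_eq_square algebra_simps)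

lemma volt_err_bar: "volt_err etabar Vbar = 0"
  by (simp add: volt_err_def equil_volt)

lemma line_err_bar: "line_err etabar Vbar = 0"
  by (simp add: line_err_def vec_eq_iff)

text \<open>This is \<open>cond_star\<close> written as edge sums. Moving the inverse voltages and
  the transposed \<open>absmat\<close> factor across the inner product puts the same edge vector
  \<open>r\<close> on both sides of the remaining diagonal factors.\<close>

lemma star_form:
  assumes "v \<noteq> 0"
  shows "0 < (\<Sum>i\<in>UNIV. F i * (v $ i)\<^sup>2) - 2 * (\<Sum>k\<in>UNIV. B k * cos (etabar $ k) * v $ ep k * v $ en k)
    - (\<Sum>k\<in>UNIV. Gam ep en B Vbar $ k * (sin (etabar $ k))\<^sup>2 / cos (etabar $ k)
        * (v $ ep k / Vbar $ ep k + v $ en k / Vbar $ en k)\<^sup>2)"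
proof -
  let ?D = "absmat (incidence ep en)"
  let ?y = "diagm (vinv Vbar) *v v"
  let ?g = "Gam ep en B Vbar"
  define r where "r = transpose ?D *v ?y"
  have r: "r $ k = v $ ep k / Vbar $ ep k + v $ en k / Vbar $ en k" for k
    unfolding r_def
    by (subst absmat_incidence_transpose_mult[of ep _ en, OF no_loop]) (simp add: vinv_def)
  have diag: "v \<bullet> (diagm a *v u) = (diagm a *v v) \<bullet> u" for a u :: "real^'n"
    by (simp add: inner_vec_def mult.assoc mult.left_commute)
  have "0 < v \<bullet> ((Emat ep en B Bs Xd Xdp etabar -
       diagm (vinv Vbar) ** ?D ** diagm ?g ** diagm (vsin etabar) ** diagm (vinv (vcos etabar)) **
       diagm (vsin etabar) ** transpose ?D ** diagm (vinv Vbar)) *v v)"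
    using star assms by (simp add: cond_star_def posdef_def)
  also have "\<dots> = (Emat ep en B Bs Xd Xdp etabar *v v) \<bullet> v
     - v \<bullet> (diagm (vinv Vbar) *v (?D *v (diagm ?g *v (diagm (vsin etabar) *v
         (diagm (vinv (vcos etabar)) *v (diagm (vsin etabar) *v r))))))"
    by (simp only: r_def matrix_vector_mult_diff_rdistrib inner_diff_right
        matrix_vector_mul_assoc matrix_mul_assoc inner_commute[of v "Emat _ _ _ _ _ _ _ *v v"])
  also have "v \<bullet> (diagm (vinv Vbar) *v (?D *v u)) = r \<bullet> u" for u
    unfolding diag r_def by (metis inner_matrix_vector_mult transpose_transpose)
  also have "r \<bullet> (diagm ?g *v (diagm (vsin etabar) *v
         (diagm (vinv (vcos etabar)) *v (diagm (vsin etabar) *v r))))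
    = (\<Sum>k\<in>UNIV. ?g $ k * (sin (etabar $ k))\<^sup>2 / cos (etabar $ k)
        * (v $ ep k / Vbar $ ep k + v $ en k / Vbar $ en k)\<^sup>2)"
    by (simp add: inner_vec_def r vsin_def vcos_def vinv_def power2_eq_square mult.assoc
        mult.left_commute)
  also have "(Emat ep en B Bs Xd Xdp etabar *v v) \<bullet> v = (\<Sum>i\<in>UNIV. F i * (v $ i)\<^sup>2)
      - 2 * (\<Sum>k\<in>UNIV. B k * cos (etabar $ k) * v $ ep k * v $ en k)"
    unfolding Emat_mult_inner[of ep en, OF no_loop]
    by (simp add: power2_eq_square sum_distrib_left algebra_simps)
  finally show ?thesis .
qed

text \<open>Completing the square in \<open>\<zeta>\<close> leaves the Schur complement of the Hessian,
  which is the form of condition (*).\<close>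
lemma potential_hess_pos:
  assumes "\<zeta> \<noteq> 0 \<or> v \<noteq> 0"
  shows "0 < potential_hess etabar Vbar \<zeta> v"
proof -
  define g where "g k = Gam ep en B Vbar $ k * cos (etabar $ k)" for k
  define \<rho> where "\<rho> k = v $ ep k / Vbar $ ep k + v $ en k / Vbar $ en k" for k
  define sq where "sq = (\<Sum>k\<in>UNIV. g k * (\<zeta> $ k + tan (etabar $ k) * \<rho> k)\<^sup>2)"
  define schur where "schur = (\<Sum>i\<in>UNIV. F i * (v $ i)\<^sup>2)
    - 2 * (\<Sum>k\<in>UNIV. B k * cos (etabar $ k) * v $ ep k * v $ en k)
    - (\<Sum>k\<in>UNIV. Gam ep en B Vbar $ k * (sin (etabar $ k))\<^sup>2 / cos (etabar $ k) * (\<rho> k)\<^sup>2)"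
  have cos: "0 < cos (etabar $ k)" for k using eta_box cos_gt_zero_pi by blast
  have V: "0 < Vbar $ i" for i using V_pos by blast
  have g: "0 < g k" for k using B_pos V cos by (simp add: g_def Gam_def)
  have edge: "B k * (Vbar $ ep k * Vbar $ en k * cos (etabar $ k) * (\<zeta> $ k)\<^sup>2
         + 2 * sin (etabar $ k) * \<zeta> $ k * (v $ ep k * Vbar $ en k + v $ en k * Vbar $ ep k)
         - 2 * cos (etabar $ k) * v $ ep k * v $ en k)
    = g k * (\<zeta> $ k + tan (etabar $ k) * \<rho> k)\<^sup>2 - 2 * (B k * cos (etabar $ k) * v $ ep k * v $ en k)
      - Gam ep en B Vbar $ k * (sin (etabar $ k))\<^sup>2 / cos (etabar $ k) * (\<rho> k)\<^sup>2" for k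
  proof -
    \<comment> \<open>Relative voltage deviations turn the mixed coefficient of the Hessian into a
      multiple of \<open>\<rho> k\<close>, so that the shift by \<open>tan\<close> completes the
      square.\<close>
    have "Vbar $ ep k * Vbar $ en k * \<rho> k = v $ ep k * Vbar $ en k + v $ en k * Vbar $ ep k"
      using V[of "ep k"] V[of "en k"] by (simp add: \<rho>_def field_simps)
    moreover have "cos (etabar $ k) * (\<zeta> $ k + tan (etabar $ k) * \<rho> k)\<^sup>2
      - (sin (etabar $ k))\<^sup>2 / cos (etabar $ k) * (\<rho> k)\<^sup>2
      = cos (etabar $ k) * (\<zeta> $ k)\<^sup>2 + 2 * sin (etabar $ k) * \<zeta> $ k * \<rho> k"
      using cos[of k] by (simp add: tan_def field_simps power2_eq_square)
    ultimately show ?thesis unfolding g_def Gam_def vec_lambda_beta by algebra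
  qed
  have "potential_hess etabar Vbar \<zeta> v = schur + sq"
    unfolding potential_hess_def edge schur_def sq_def
    by (simp add: sum.distrib sum_subtractf sum_distrib_left)
  moreover have "0 \<le> sq" unfolding sq_def using g by (intro sum_nonneg) (simp add: less_imp_le)
  moreover have "0 < schur" if "v \<noteq> 0" using star_form[OF that] by (simp add: schur_def \<rho>_def)
  \<comment> \<open>Without voltage deviation both \<open>schur\<close> and \<open>\<rho>\<close>
    vanish; the angle squares must supply strict positivity.\<close>
  moreover have "0 < schur + sq" if "v = 0" "\<zeta> \<noteq> 0"
  proof -
    obtain k where k: "\<zeta> $ k \<noteq> 0" using \<open>\<zeta> \<noteq> 0\<close> by (auto simp: vec_eq_iff)
    have "0 < (\<Sum>k\<in>UNIV. g k * (\<zeta> $ k)\<^sup>2)"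
      using g k by (intro sum_pos2[of _ k]) (auto simp: less_imp_le)
    then show ?thesis using that(1) by (simp add: schur_def sq_def \<rho>_def)
  qed
  ultimately show ?thesis using assms by fastforce
qed

lemma potential_strict_local_min:
  obtains r where "0 < r"
    "\<And>eta V. (eta, V) \<noteq> (etabar, Vbar) \<Longrightarrow> dist (etabar, Vbar) (eta, V) < r
       \<Longrightarrow> potential etabar Vbar < potential eta V"
proof (rule strict_local_min_of_pos_second_variation[where y = "(etabar, Vbar)"
      and f = "\<lambda>y. potential (fst y) (snd y)"
      and df = "\<lambda>y z. potential_diff (fst y) (snd y) (fst z) (snd z)"
      and d2f = "\<lambda>y z. potential_hess (fst y) (snd y) (fst z) (snd z)"])
  show "continuous_on UNIV (\<lambda>(x, z). potential_hess (fst x) (snd x) (fst z) (snd z))"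
    unfolding potential_hess_def case_prod_beta by (intro continuous_intros)
next
  fix x z :: "(real^'m) \<times> (real^'n)" and c :: real
  show "potential_hess (fst x) (snd x) (fst (c *\<^sub>R z)) (snd (c *\<^sub>R z))
    = c\<^sup>2 * potential_hess (fst x) (snd x) (fst z) (snd z)"
    by (simp add: potential_hess_def sum_distrib_left power2_eq_square algebra_simps)
next
  fix z :: "(real^'m) \<times> (real^'n)" assume "z \<noteq> 0"
  then show "0 < potential_hess (fst (etabar, Vbar)) (snd (etabar, Vbar)) (fst z) (snd z)"
    using potential_hess_pos[of "fst z" "snd z"] by (simp add: prod_eq_iff)
next
  fix z :: "(real^'m) \<times> (real^'n)"
  show "potential_diff (fst (etabar, Vbar)) (snd (etabar, Vbar)) (fst z) (snd z) = 0"
    by (simp add: potential_diff_def volt_err_bar line_err_bar)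
next
  fix z :: "(real^'m) \<times> (real^'n)" and s :: real
  let ?y = "\<lambda>s. (etabar, Vbar) + s *\<^sub>R z"
  show "((\<lambda>s. potential (fst (?y s)) (snd (?y s))) has_real_derivative
      potential_diff (fst (?y s)) (snd (?y s)) (fst z) (snd z)) (at s)"
    by (rule potential_has_derivative) (auto intro!: derivative_eq_intros)
  show "((\<lambda>s. potential_diff (fst (?y s)) (snd (?y s)) (fst z) (snd z)) has_real_derivative
      potential_hess (fst (?y s)) (snd (?y s)) (fst z) (snd z)) (at s)"
    by (rule potential_diff_has_derivative) (auto intro!: derivative_eq_intros)
qed (use that in auto)

end

subsection \<open>Dissipation in error coordinates\<close>

lemmas has_vector_derivative_fst = bounded_linear.has_vector_derivative[OF bounded_linear_fst]
lemmas has_vector_derivative_snd = bounded_linear.has_vector_derivative[OF bounded_linear_snd]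
lemmas has_vector_derivative_vec_nth = bounded_linear.has_vector_derivative[OF bounded_linear_vec_nth]

lemma bounded_linear_replicate: "bounded_linear (\<lambda>v::real^'p::finite. (\<chi> i. v) :: real^'p^'n::finite)"
  by (intro linear_conv_bounded_linear[THEN iffD1] linearI) (auto simp: vec_eq_iff)

text \<open>Error coordinates
  \<open>(\<eta>, \<omega>, V, \<theta>\<^sub>1 - \<theta>\<^sub>1bar, \<theta>\<^sub>2 - \<one> \<otimes> \<sigma>\<^sub>2)\<close>; in them the closed loop is autonomous.\<close>
type_synonym ('m, 'n, 'p) errstate =
  "(real^'m) \<times> (real^'n) \<times> (real^'n) \<times> (real^'n) \<times> (real^'p^'n)"

context controlled_network
begin

abbreviation (input) eta_of :: "('m, 'n, 'p) errstate \<Rightarrow> real^'m" where "eta_of z \<equiv> fst z"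
abbreviation (input) w_of :: "('m, 'n, 'p) errstate \<Rightarrow> real^'n" where "w_of z \<equiv> fst (snd z)"
abbreviation (input) V_of :: "('m, 'n, 'p) errstate \<Rightarrow> real^'n" where "V_of z \<equiv> fst (snd (snd z))"
abbreviation (input) p_of :: "('m, 'n, 'p) errstate \<Rightarrow> real^'n" where "p_of z \<equiv> fst (snd (snd (snd z)))"
abbreviation (input) e_of :: "('m, 'n, 'p) errstate \<Rightarrow> real^'p^'n" where "e_of z \<equiv> snd (snd (snd (snd z)))"

abbreviation "net_field \<equiv> clfield ep en B Bs Xd Xdp Mi Ai Ti Efd q pi1 s1 S2 R2 Gc"

definition err_field :: "('m, 'n, 'p) errstate \<Rightarrow> ('m, 'n, 'p) errstate" where
  "err_field z = (transpose (incidence ep en) *v w_of z,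
     (\<chi> i. (ctrl_u q R2 (p_of z) (e_of z) $ i - flow_err (eta_of z) (V_of z) $ i - Ai i * w_of z $ i) / Mi i),
     (\<chi> i. - volt_err (eta_of z) (V_of z) $ i / Ti i),
     (\<chi> i. (\<Sum>j\<in>{j. Gc i j}. p_of z $ j - p_of z $ i) - w_of z $ i / q i),
     (\<chi> i. S2 *v (e_of z $ i) - (w_of z $ i / q i) *\<^sub>R R2))"

text \<open>Only the controller slots carry a moving reference. Angles and voltages stay absolute,
  so the operating point in error coordinates is (\<open>etabar\<close>, 0, \<open>Vbar\<close>, 0,
  0) rather than the origin.\<close>

definition operating_ctrl :: "real \<Rightarrow> ('m, 'n, 'p) errstate" where
  "operating_ctrl t = (0, 0, 0, theta1bar q pi1 s1, \<chi> i. s2 t)"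

lemma sum_inverse_q_pos: "0 < (\<Sum>j\<in>UNIV. 1 / q j)"
  using q_pos by (intro sum_pos) auto

text \<open>The optimal feedforward is the controller output at the reference state: summing the
  demand over the nodes multiplies the oscillating term by the sum of the \<open>1 / q j\<close>,
  which the denominator of \<open>ubar\<close> cancels.\<close>

lemma ubar_eq: "ubar q (demand q pi1 s1 R2 s) = ctrl_u q R2 (theta1bar q pi1 s1) (\<chi> i. s)"
proof -
  have "(\<Sum>j\<in>UNIV. demand q pi1 s1 R2 s $ j)
      = (\<Sum>j\<in>UNIV. pi1 j * s1 $ j) + (R2 \<bullet> s) * (\<Sum>j\<in>UNIV. 1 / q j)"
    by (simp add: demand_def sum.distrib sum_distrib_left)
  then show ?thesis
    using sum_inverse_q_pos by (simp add: ubar_def ctrl_u_def theta1bar_def vec_eq_iff add_divide_distrib)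
qed

lemma flow_err_eq:
  "incidence ep en *v (\<chi> k. Gam ep en B V $ k * sin (eta $ k))
    = flow_err eta V + incidence ep en *v (\<chi> k. Gam ep en B Vbar $ k * sin (etabar $ k))"
proof -
  have "(\<chi> k. Gam ep en B V $ k * sin (eta $ k))
      = line_err eta V + (\<chi> k. Gam ep en B Vbar $ k * sin (etabar $ k))"
    by (simp add: line_err_def vec_eq_iff)
  then show ?thesis by (simp add: flow_err_def matrix_vector_right_distrib)
qed

lemma operating_balance:
  "ctrl_u q R2 (theta1bar q pi1 s1) (\<chi> i. s2 t)
    - incidence ep en *v (\<chi> k. Gam ep en B Vbar $ k * sin (etabar $ k)) = demand q pi1 s1 R2 (s2 t)"
  using equil_flow[rule_format, of t] unfolding ubar_eq by (simp add: algebra_simps)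

lemma ctrl_u_add: "ctrl_u q R2 (p + p') (e + e') = ctrl_u q R2 p e + ctrl_u q R2 p' e'"
  by (simp add: ctrl_u_def vec_eq_iff inner_add_right add_divide_distrib)

text \<open>The closed loop splits into an autonomous error field and the velocity of the reference.
  The demand is absorbed by \<open>operating_balance\<close>, and the reference drops out of the
  consensus terms because \<open>theta1bar\<close> has equal entries.\<close>

lemma net_field_eq:
  "net_field (z + operating_ctrl t, s2 t) = (err_field z + (0, 0, 0, 0, \<chi> i. S2 *v s2 t), S2 *v s2 t)"
proof -
  obtain eta w V p e where z: "z = (eta, w, V, p, e)" by (cases z) auto
  have dem: "demand q pi1 s1 R2 (s2 t) $ i = ctrl_u q R2 (theta1bar q pi1 s1) (\<chi> i. s2 t) $ i
    - (incidence ep en *v (\<chi> k. Gam ep en B Vbar $ k * sin (etabar $ k))) $ i" for i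
    by (simp flip: operating_balance)
  have "(\<Sum>j\<in>{j. Gc i j}. (p + theta1bar q pi1 s1) $ j - (p + theta1bar q pi1 s1) $ i)
      = (\<Sum>j\<in>{j. Gc i j}. p $ j - p $ i)" for i
    by (simp add: theta1bar_def)
  then show ?thesis
    by (simp add: clfield_def z operating_ctrl_def err_field_def Let_def vec_eq_iff ctrl_u_add
        flow_err_eq[of V eta] dem volt_err_def matrix_vector_right_distrib del: transpose_matrix_vector)
qed

section \<open>The Lyapunov function and its dissipation\<close>

definition lyap :: "('m, 'n, 'p) errstate \<Rightarrow> real" where
  "lyap z = (\<Sum>i\<in>UNIV. Mi i * (w_of z $ i)\<^sup>2) / 2 + potential (eta_of z) (V_of z)
     + (p_of z \<bullet> p_of z) / 2 + (e_of z \<bullet> e_of z) / 2"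

definition dissipation :: "('m, 'n, 'p) errstate \<Rightarrow> real" where
  "dissipation z = (\<Sum>i\<in>UNIV. Ai i * (w_of z $ i)\<^sup>2)
     + (\<Sum>i\<in>UNIV. (volt_err (eta_of z) (V_of z) $ i)\<^sup>2 / Ti i)
     + (\<Sum>i\<in>UNIV. \<Sum>j\<in>{j. Gc i j}. (p_of z $ i - p_of z $ j)\<^sup>2) / 2"

definition err_bar :: "('m, 'n, 'p) errstate" where
  "err_bar = (etabar, 0, Vbar, 0, 0)"

lemma dissipation_nonneg: "0 \<le> dissipation z"
  unfolding dissipation_def using MAT_pos
  by (intro add_nonneg_nonneg sum_nonneg divide_nonneg_nonneg) (auto simp: less_imp_le)

text \<open>All summands are nonnegative, so each vanishes. Connectivity of the communication graph
  turns equality between neighbours into consensus, which leaves the common value of the \<theta>1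
  errors still undetermined.\<close>

lemma dissipation_eq_0D:
  assumes "dissipation z = 0"
  shows "w_of z = 0" "volt_err (eta_of z) (V_of z) = 0" "p_of z $ i = p_of z $ j"
proof -
  let ?a = "\<Sum>i\<in>UNIV. Ai i * (w_of z $ i)\<^sup>2"
    and ?b = "\<Sum>i\<in>UNIV. (volt_err (eta_of z) (V_of z) $ i)\<^sup>2 / Ti i"
    and ?c = "\<Sum>i\<in>UNIV. \<Sum>j\<in>{j. Gc i j}. (p_of z $ i - p_of z $ j)\<^sup>2"
  have "0 \<le> ?a" "0 \<le> ?b" "0 \<le> ?c"
    using MAT_pos by (auto intro!: sum_nonneg divide_nonneg_nonneg simp: less_imp_le)
  then have "?a = 0" "?b = 0" "?c = 0"
    using assms by (auto simp: dissipation_def)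
  then have w: "Ai i * (w_of z $ i)\<^sup>2 = 0" and V: "(volt_err (eta_of z) (V_of z) $ i)\<^sup>2 / Ti i = 0"
    and p: "(\<Sum>j\<in>{j. Gc i j}. (p_of z $ i - p_of z $ j)\<^sup>2) = 0" for i
    using sum_nonneg_eq_0_iff[of UNIV "\<lambda>i. Ai i * (w_of z $ i)\<^sup>2"]
      sum_nonneg_eq_0_iff[of UNIV "\<lambda>i. (volt_err (eta_of z) (V_of z) $ i)\<^sup>2 / Ti i"]
      sum_nonneg_eq_0_iff[of UNIV "\<lambda>i. \<Sum>j\<in>{j. Gc i j}. (p_of z $ i - p_of z $ j)\<^sup>2"] MAT_pos
    by (simp_all add: less_imp_le sum_nonneg del: mult_eq_0_iff divide_eq_0_iff)
  have "Ai i \<noteq> 0" "Ti i \<noteq> 0" for i using MAT_pos by (metis less_irrefl)+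
  then show "w_of z = 0" "volt_err (eta_of z) (V_of z) = 0" using w V by (auto simp: vec_eq_iff)
  have "p_of z $ i = p_of z $ j" if "Gc i j" for i j
    using p[of i] that by (simp add: sum_nonneg_eq_0_iff)
  then show "p_of z $ i = p_of z $ j" using consensus_of_connected[OF comm] by blast
qed

lemma state_has_derivative:
  fixes z :: "real \<Rightarrow> ('m, 'n, 'p) errstate"
  assumes "(z has_vector_derivative z') (at t within X)"
  shows eta_has_derivative:
      "((\<lambda>t. eta_of (z t) $ k) has_real_derivative eta_of z' $ k) (at t within X)"
    and w_has_derivative:
      "((\<lambda>t. w_of (z t) $ i) has_real_derivative w_of z' $ i) (at t within X)"
    and V_has_derivative:
      "((\<lambda>t. V_of (z t) $ i) has_real_derivative V_of z' $ i) (at t within X)"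
    and p_has_derivative:
      "((\<lambda>t. p_of (z t) $ i) has_real_derivative p_of z' $ i) (at t within X)"
  unfolding has_real_derivative_iff_has_vector_derivative
  by (intro has_vector_derivative_vec_nth has_vector_derivative_fst has_vector_derivative_snd
      assms)+

text \<open>This is a power balance. The line power \<open>flow_err\<close> times \<omega> enters
  the kinetic and potential rates with opposite signs, and the power of \<open>ctrl_u\<close> is
  cancelled by the \<omega> terms of the two controller rates. Damping, voltage and consensus losses
  remain.\<close>

lemma lyap_has_derivative:
  assumes "(z has_vector_derivative err_field (z t)) (at t within X)"
  shows "((\<lambda>t. lyap (z t)) has_real_derivative - dissipation (z t)) (at t within X)"
proof -
  let ?eta = "eta_of (z t)" and ?w = "w_of (z t)" and ?V = "V_of (z t)" and ?p = "p_of (z t)"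
    and ?e = "e_of (z t)" and ?z' = "err_field (z t)"
  note snd = has_vector_derivative_snd and fst = has_vector_derivative_fst
  have p: "((\<lambda>t. p_of (z t) \<bullet> p_of (z t)) has_real_derivative 2 * (?p \<bullet> p_of ?z')) (at t within X)"
    unfolding has_real_derivative_iff_has_vector_derivative
    using bounded_bilinear.has_vector_derivative[OF bounded_bilinear_inner, of "\<lambda>t. p_of (z t)" _ t X
        "\<lambda>t. p_of (z t)"] fst[OF snd[OF snd[OF snd[OF assms]]]]
    by (fastforce simp: inner_commute)
  have e: "((\<lambda>t. e_of (z t) \<bullet> e_of (z t)) has_real_derivative 2 * (?e \<bullet> e_of ?z')) (at t within X)"
    unfolding has_real_derivative_iff_has_vector_derivative
    using bounded_bilinear.has_vector_derivative[OF bounded_bilinear_inner, of "\<lambda>t. e_of (z t)" _ t X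
        "\<lambda>t. e_of (z t)"] snd[OF snd[OF snd[OF snd[OF assms]]]]
    by (fastforce simp: inner_commute)
  have deriv: "((\<lambda>t. lyap (z t)) has_real_derivative (\<Sum>i\<in>UNIV. Mi i * (?w $ i * w_of ?z' $ i))
      + potential_diff ?eta ?V (eta_of ?z') (V_of ?z') + ?p \<bullet> p_of ?z' + ?e \<bullet> e_of ?z') (at t within X)"
    unfolding lyap_def
    by (rule derivative_eq_intros w_has_derivative[OF assms] p e
        potential_has_derivative[OF eta_has_derivative V_has_derivative, OF assms assms] refl | simp)+
       (simp add: sum_distrib_left algebra_simps)
  have M: "Mi i \<noteq> 0" for i using MAT_pos by (metis less_irrefl)
  have Mw: "Mi i * w_of ?z' $ i = ctrl_u q R2 ?p ?e $ i - flow_err ?eta ?V $ i - Ai i * ?w $ i" for i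
    by (simp add: err_field_def M)
  have kinetic: "(\<Sum>i\<in>UNIV. Mi i * (?w $ i * w_of ?z' $ i))
      = ctrl_u q R2 ?p ?e \<bullet> ?w - flow_err ?eta ?V \<bullet> ?w - (\<Sum>i\<in>UNIV. Ai i * (?w $ i)\<^sup>2)"
    unfolding mult.left_commute[of "Mi _"] Mw
    by (simp add: inner_vec_def sum_subtractf[symmetric] power2_eq_square algebra_simps)
  have pot: "potential_diff ?eta ?V (eta_of ?z') (V_of ?z')
      = flow_err ?eta ?V \<bullet> ?w - (\<Sum>i\<in>UNIV. (volt_err ?eta ?V $ i)\<^sup>2 / Ti i)"
    by (simp add: potential_diff_def err_field_def flow_err_def inner_matrix_vector_mult inner_vec_def[of "volt_err ?eta ?V"]
        power2_eq_square sum_negf del: transpose_matrix_vector)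
  have lapl: "?p \<bullet> p_of ?z' = - (\<Sum>i\<in>UNIV. \<Sum>j\<in>{j. Gc i j}. (?p $ i - ?p $ j)\<^sup>2) / 2
      - (\<Sum>i\<in>UNIV. ?p $ i / q i * ?w $ i)"
    using Laplacian_form[of Gc ?p] comm
    by (simp add: err_field_def inner_vec_def[of ?p] right_diff_distrib sum_subtractf connected_undirected_def)
  have osc: "?e \<bullet> e_of ?z' = - (\<Sum>i\<in>UNIV. (R2 \<bullet> ?e $ i) / q i * ?w $ i)"
    by (simp add: err_field_def inner_vec_def[of ?e] inner_diff_right sum_negf
        skew_quadratic_form_eq_0[OF S2_skew] inner_commute[of R2] mult.commute)
  have "ctrl_u q R2 ?p ?e \<bullet> ?w = (\<Sum>i\<in>UNIV. ?p $ i / q i * ?w $ i) + (\<Sum>i\<in>UNIV. (R2 \<bullet> ?e $ i) / q i * ?w $ i)"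
    by (simp add: ctrl_u_def inner_vec_def[of _ ?w] distrib_right sum.distrib)
  then show ?thesis using deriv unfolding kinetic pot lapl osc
    by (simp add: dissipation_def algebra_simps)
qed

lemma lyap_strict_local_min:
  obtains r where "0 < r" "\<And>z. z \<noteq> err_bar \<Longrightarrow> dist err_bar z < r \<Longrightarrow> lyap err_bar < lyap z"
proof -
  obtain r where "0 < r" and r: "\<And>eta V. (eta, V) \<noteq> (etabar, Vbar) \<Longrightarrow>
      dist (etabar, Vbar) (eta, V) < r \<Longrightarrow> potential etabar Vbar < potential eta V"
    using potential_strict_local_min by blast
  have "lyap err_bar < lyap z" if "z \<noteq> err_bar" "dist err_bar z < r" for z
  proof -
    obtain eta w V p e where z: "z = (eta, w, V, p, e)" by (cases z) auto
    \<comment> \<open>Projecting onto angles and voltages does not increase distances, so the radius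
      found for the potential serves here as well.\<close>
    have "dist (etabar, Vbar) (eta, V) \<le> dist err_bar z"
      unfolding z err_bar_def dist_Pair_Pair by (simp add: real_sqrt_le_mono)
    then have pot: "(eta, V) \<noteq> (etabar, Vbar) \<Longrightarrow> potential etabar Vbar < potential eta V"
      using r that(2) by auto
    have kin: "0 \<le> (\<Sum>i\<in>UNIV. Mi i * (w $ i)\<^sup>2)"
      using MAT_pos by (intro sum_nonneg) (simp add: less_imp_le)
    have pos: "0 < (\<Sum>i\<in>UNIV. Mi i * (w $ i)\<^sup>2)" if "w \<noteq> 0"
    proof -
      obtain i where "w $ i \<noteq> 0" using \<open>w \<noteq> 0\<close> by (auto simp: vec_eq_iff)
      then show ?thesis using MAT_pos by (intro sum_pos2[of _ i]) (auto simp: less_imp_le)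
    qed
    have "w \<noteq> 0 \<or> p \<noteq> 0 \<or> e \<noteq> 0 \<or> (eta, V) \<noteq> (etabar, Vbar)"
      using that(1) by (auto simp: z err_bar_def)
    moreover have "0 < p \<bullet> p" if "p \<noteq> 0" using that by simp
    moreover have "0 < e \<bullet> e" if "e \<noteq> 0" using that by simp
    ultimately have "potential etabar Vbar < (\<Sum>i\<in>UNIV. Mi i * (w $ i)\<^sup>2) / 2 + potential eta V + (p \<bullet> p) / 2 + (e \<bullet> e) / 2"
      using pot kin pos inner_ge_zero[of p] inner_ge_zero[of e]
      by (cases "(eta, V) = (etabar, Vbar)") (smt (verit) field_sum_of_halves Pair_inject)+
    then show ?thesis by (simp add: lyap_def z err_bar_def)
  qed
  then show thesis using that \<open>0 < r\<close> by blast
qed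

lemma continuous_volt_err [continuous_intros]:
  fixes f :: "'z::t2_space \<Rightarrow> real^'m"
  assumes "continuous_on X f" "continuous_on X g"
  shows "continuous_on X (\<lambda>z. volt_err (f z) (g z) $ i)"
proof -
  have "continuous_on X (\<lambda>z. (if ep k = i then g z $ en k else 0) + (if en k = i then g z $ ep k else 0))" for k
    by (cases "ep k = i"; cases "en k = i") (simp; intro continuous_intros assms)+
  then show ?thesis
    unfolding volt_err_def vector_minus_component Emat_mult[of ep en, OF no_loop]
    by (intro continuous_on_diff continuous_on_sum continuous_on_mult continuous_on_const
        continuous_on_cos continuous_on_component assms)
qed

lemma continuous_flow_err [continuous_intros]:
  fixes f :: "'z::t2_space \<Rightarrow> real^'m"
  assumes "continuous_on X f" "continuous_on X g"
  shows "continuous_on X (\<lambda>z. flow_err (f z) (g z) $ i)"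
  unfolding flow_err_def line_err_def Gam_def matrix_vector_mult_def vec_lambda_beta
  by (intro continuous_intros assms)

lemma continuous_potential [continuous_intros]:
  fixes f :: "'z::t2_space \<Rightarrow> real^'m"
  assumes "continuous_on X f" "continuous_on X g"
  shows "continuous_on X (\<lambda>z. potential (f z) (g z))"
  unfolding potential_def by (intro continuous_intros assms) simp

lemma continuous_lyap: "continuous_on X lyap"
  unfolding lyap_def[abs_def] by (intro continuous_intros) simp_all

lemma continuous_dissipation: "continuous_on X dissipation"
  unfolding dissipation_def[abs_def] using MAT_pos
  by (intro continuous_intros) (auto simp: less_imp_neq[symmetric])

end

subsection \<open>Equilibria and their invariance\<close>

context controlled_network
begin

lemma lyap_nonincreasing:
  assumes z: "\<And>t. 0 \<le> t \<Longrightarrow> (z has_vector_derivative err_field (z t)) (at t within {0..})"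
    and "0 \<le> s" "s \<le> t"
  shows "lyap (z t) \<le> lyap (z s)"
proof (cases "s = t")
  case False
  then have "s < t" using \<open>s \<le> t\<close> by simp
  have "\<exists>\<xi>\<in>{s<..<t}. lyap (z t) - lyap (z s) = (t - s) * - dissipation (z \<xi>)"
  proof (rule mvt_simple[where f' = "\<lambda>u h. h * - dissipation (z u)", OF \<open>s < t\<close>])
    fix u assume "s \<le> u" "u \<le> t"
    then have "((\<lambda>t. lyap (z t)) has_real_derivative - dissipation (z u)) (at u within {s..t})"
      using lyap_has_derivative[where z = z, OF z[of u]] \<open>0 \<le> s\<close> by (auto intro: DERIV_subset)
    then show "((\<lambda>t. lyap (z t)) has_derivative (\<lambda>h. h * - dissipation (z u))) (at u within {s..t})"
      by (simp only: has_field_derivative_def mult_commute_abs)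
  qed
  then obtain \<xi> where "lyap (z t) - lyap (z s) = - ((t - s) * dissipation (z \<xi>))" by auto
  moreover have "0 \<le> (t - s) * dissipation (z \<xi>)"
    using \<open>s < t\<close> dissipation_nonneg by simp
  ultimately show ?thesis by linarith
qed simp

text \<open>The observability form is evaluated at \<open>S2 *v e\<close>: the output \<open>R2 \<bullet> e\<close> itself is only
  seen through its sum with \<open>\<theta>\<^sub>1 - \<theta>\<^sub>1bar\<close>, its derivatives are seen alone.\<close>
definition residual :: "('m, 'n, 'p) errstate \<Rightarrow> real" where
  "residual z = dissipation z
     + (\<Sum>i\<in>UNIV. (ctrl_u q R2 (p_of z) (e_of z) $ i - flow_err (eta_of z) (V_of z) $ i)\<^sup>2)
     + (\<Sum>i\<in>UNIV. \<Sum>k<CARD('p). (R2 \<bullet> (((*v) S2 ^^ Suc k) (e_of z $ i)))\<^sup>2)"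

text \<open>Zero dissipation gives rest, voltage balance and consensus; observability removes the
  oscillator errors. The node balance then makes each flow error equal to \<open>p / q\<close>, and
  since flows sum to zero over the nodes, the consensus value is zero.\<close>

lemma residual_eq_0D:
  assumes "residual z = 0"
  shows "w_of z = 0" "volt_err (eta_of z) (V_of z) = 0" "p_of z = 0" "e_of z = 0"
    "flow_err (eta_of z) (V_of z) = 0"
proof -
  let ?a = "\<lambda>i. (ctrl_u q R2 (p_of z) (e_of z) $ i - flow_err (eta_of z) (V_of z) $ i)\<^sup>2"
    and ?b = "\<lambda>i k. (R2 \<bullet> (((*v) S2 ^^ Suc k) (e_of z $ i)))\<^sup>2"
  have "0 \<le> (\<Sum>i\<in>UNIV. ?a i)" "0 \<le> (\<Sum>i\<in>UNIV. \<Sum>k<CARD('p). ?b i k)"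
    by (auto intro!: sum_nonneg)
  then have diss: "dissipation z = 0" and "(\<Sum>i\<in>UNIV. ?a i) = 0" "(\<Sum>i\<in>UNIV. \<Sum>k<CARD('p). ?b i k) = 0"
    using assms dissipation_nonneg[of z] unfolding residual_def by linarith+
  then have a: "?a i = 0" and "(\<Sum>k<CARD('p). ?b i k) = 0" for i
    using sum_nonneg_eq_0_iff[of UNIV ?a] sum_nonneg_eq_0_iff[of UNIV "\<lambda>i. \<Sum>k<CARD('p). ?b i k"]
    by (simp_all add: sum_nonneg)
  then have b: "?b i k = 0" if "k < CARD('p)" for i k
    using sum_nonneg_eq_0_iff[of "{..<CARD('p)}" "?b i"] that by (simp del: funpow.simps)
  show "w_of z = 0" "volt_err (eta_of z) (V_of z) = 0" using dissipation_eq_0D[OF diss] by auto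
  show e: "e_of z = 0"
  proof (rule vec_eq_iff[THEN iffD2], rule allI)
    fix i
    \<comment> \<open>One power of \<open>S2\<close> is moved onto the error, so observability
      yields \<open>S2 *v e = 0\<close>, and nonsingularity of \<open>S2\<close> finishes.\<close>
    have "R2 \<bullet> (((*v) S2 ^^ k) (S2 *v (e_of z $ i))) = 0" if "k < CARD('p)" for k
      using b[OF that, of i] by (simp add: funpow_swap1)
    then have "S2 *v (e_of z $ i) = 0" using obs by (simp add: observable_def)
    then show "e_of z $ i = 0 $ i" using S2_nonsing by auto
  qed
  have bal: "flow_err (eta_of z) (V_of z) $ i = p_of z $ i / q i" for i
    using a[of i] by (simp add: e ctrl_u_def)
  have "p_of z $ i = 0" for i
  proof -
    \<comment> \<open>Every column of the incidence matrix sums to zero, so the all-ones vector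
      annihilates the flows.\<close>
    have "0 = flow_err (eta_of z) (V_of z) \<bullet> (\<chi> j. 1)"
      by (simp add: flow_err_def incidence_mult_inner[of ep en, OF no_loop])
    also have "\<dots> = (\<Sum>j\<in>UNIV. p_of z $ j / q j)" by (simp add: inner_vec_def bal)
    also have "\<dots> = (\<Sum>j\<in>UNIV. p_of z $ i * (1 / q j))"
    proof (rule sum.cong)
      fix j show "p_of z $ j / q j = p_of z $ i * (1 / q j)"
        using dissipation_eq_0D(3)[OF diss, of j i] by simp
    qed simp
    also have "\<dots> = p_of z $ i * (\<Sum>j\<in>UNIV. 1 / q j)" by (simp add: sum_distrib_left)
    finally show ?thesis using sum_inverse_q_pos by simp
  qed
  then show "p_of z = 0" by (simp add: vec_eq_iff)
  then show "flow_err (eta_of z) (V_of z) = 0" using bal by (simp add: vec_eq_iff)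
qed

lemma bounded_linear_output: "bounded_linear (\<lambda>v. R2 \<bullet> (((*v) S2 ^^ k) v))"
proof -
  have "linear ((*v) S2 ^^ k)"
    by (induction k) (auto intro: linear_compose simp: linear_id[unfolded id_def] id_def linear_iff
        matrix_vector_right_distrib matrix_vector_mult_scaleR)
  then show ?thesis
    by (intro bounded_linear_compose[OF bounded_linear_inner_right] linear_conv_bounded_linear[THEN iffD1])
qed

text \<open>Shows that the zero set of \<open>residual\<close> is nonempty, as the later distance
  argument requires.\<close>

lemma residual_err_bar: "residual err_bar = 0"
  by (simp add: residual_def dissipation_def err_bar_def volt_err_bar flow_err_def line_err_bar
      ctrl_u_def linear_simps(3)[OF bounded_linear_output] del: funpow.simps)

lemma err_field_eq_0:
  assumes "residual z = 0"
  shows "err_field z = 0"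
  by (simp add: residual_eq_0D[OF assms] err_field_def ctrl_u_def prod_eq_iff vec_eq_iff[of _ 0])

lemma operating_ctrl_has_derivative:
  "(operating_ctrl has_vector_derivative (0, 0, 0, 0, \<chi> i. S2 *v s2 t)) (at t within X)"
  unfolding operating_ctrl_def[abs_def]
  using exo by (intro has_vector_derivative_Pair has_vector_derivative_const
      bounded_linear.has_vector_derivative[OF bounded_linear_replicate])
    (auto intro: has_vector_derivative_at_within)

text \<open>No existence theorem for differential equations is needed: solutions through these points are
  time shifts of the given exosystem solution.\<close>
lemma invariant_equilibria:
  "invariant_set net_field {(y + operating_ctrl \<tau>, s2 \<tau>) | y \<tau>. residual y = 0}"
  unfolding invariant_set_def
proof (intro ballI)
  fix x0 assume "x0 \<in> {(y + operating_ctrl \<tau>, s2 \<tau>) | y \<tau>. residual y = 0}"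
  then obtain y \<tau> where x0: "x0 = (y + operating_ctrl \<tau>, s2 \<tau>)" and y: "residual y = 0" by auto
  let ?x = "\<lambda>t. (y + operating_ctrl (\<tau> + t), s2 (\<tau> + t))"
  have "(?x has_vector_derivative net_field (?x t)) (at t)" for t
  proof -
    have "((\<lambda>t. (y + operating_ctrl t, s2 t)) has_vector_derivative
        ((0, 0, 0, 0, \<chi> i. S2 *v s2 (\<tau> + t)), S2 *v s2 (\<tau> + t))) (at (\<tau> + t))"
      using has_vector_derivative_add[OF has_vector_derivative_const operating_ctrl_has_derivative]
      by (intro has_vector_derivative_Pair exo[rule_format]) simp
    moreover have "((\<lambda>t. \<tau> + t) has_vector_derivative 1) (at t)"
      by (auto intro!: derivative_eq_intros simp flip: has_real_derivative_iff_has_vector_derivative)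
    ultimately have "(?x has_vector_derivative ((0, 0, 0, 0, \<chi> i. S2 *v s2 (\<tau> + t)), S2 *v s2 (\<tau> + t))) (at t)"
      using vector_diff_chain_at[of "\<lambda>t. \<tau> + t" 1 t] by (fastforce simp: o_def)
    then show ?thesis unfolding net_field_eq err_field_eq_0[OF y] by simp
  qed
  then show "\<exists>x. x 0 = x0 \<and> (\<forall>t. (x has_vector_derivative net_field (x t)) (at t)) \<and>
      (\<forall>t. x t \<in> {(y + operating_ctrl \<tau>, s2 \<tau>) | y \<tau>. residual y = 0})"
  proof (intro exI[of _ ?x] conjI allI)
    show "?x 0 = x0" by (simp add: x0)
  qed (use y in blast)+
qed

lemma equilibria_in_largest_invariant_subset:
  assumes "residual y = 0"
  shows "(y + operating_ctrl \<tau>, s2 \<tau>) \<in> largest_invariant_subset net_field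
    {((eta, w, V, th1, th2), s). w = 0 \<and> Emat ep en B Bs Xd Xdp eta *v V - Efd = 0 \<and>
              th1 = theta1bar q pi1 s1 \<and> th2 = (\<chi> i. s)}"
proof -
  let ?M = "{(y + operating_ctrl \<tau>, s2 \<tau>) | y \<tau>. residual y = 0}"
  have "?M \<subseteq> {((eta, w, V, th1, th2), s). w = 0 \<and> Emat ep en B Bs Xd Xdp eta *v V - Efd = 0 \<and>
              th1 = theta1bar q pi1 s1 \<and> th2 = (\<chi> i. s)}"
    using residual_eq_0D by (auto simp: operating_ctrl_def volt_err_def)
  then show ?thesis
    unfolding largest_invariant_subset_def using invariant_equilibria assms by blast
qed

section \<open>Continuity along trajectories and an energy barrier\<close>

lemma continuous_ctrl_u [continuous_intros]:
  assumes "continuous_on X f" "continuous_on X g"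
  shows "continuous_on X (\<lambda>z. ctrl_u q R2 (f z) (g z) $ i)"
  unfolding ctrl_u_def vec_lambda_beta using q_pos
  by (intro continuous_intros assms) (auto simp: less_imp_neq[symmetric])

lemma continuous_mult_vec [continuous_intros]:
  fixes A :: "real^'a::finite^'b::finite"
  shows "continuous_on X f \<Longrightarrow> continuous_on X (\<lambda>z. A *v f z)"
  by (rule bounded_linear.continuous_on[OF matrix_vector_mul_bounded_linear])

lemma continuous_funpow_mult_vec [continuous_intros]:
  fixes A :: "real^'a::finite^'a"
  shows "continuous_on X f \<Longrightarrow> continuous_on X (\<lambda>z. ((*v) A ^^ k) (f z))"
  by (induction k) (auto intro!: continuous_mult_vec)

lemma continuous_err_field: "continuous_on X err_field"
  unfolding err_field_def[abs_def] using MAT_pos q_pos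
  by (intro continuous_intros) (auto simp: less_imp_neq[symmetric])

lemma continuous_residual: "continuous_on X residual"
  unfolding residual_def[abs_def]
  by (intro continuous_intros continuous_dissipation)

text \<open>The barrier level \<open>m\<close> is the minimum of \<open>lyap\<close> on a compact
  sphere inside the region of the strict local minimum.\<close>

lemma attraction_region:
  obtains r m where "0 < r" "lyap err_bar < m" "\<And>z. dist err_bar z = r \<Longrightarrow> m \<le> lyap z"
proof -
  obtain r where "0 < r" and r: "\<And>z. z \<noteq> err_bar \<Longrightarrow> dist err_bar z < r \<Longrightarrow> lyap err_bar < lyap z"
    using lyap_strict_local_min by blast
  \<comment> \<open>Half the radius keeps the sphere inside the open ball where \<open>lyap\<close>
    exceeds its value at \<open>err_bar\<close>.\<close>
  let ?S = "sphere err_bar (r / 2)"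
  show thesis
  proof (cases "?S = {}")
    case True
    then have "dist err_bar z \<noteq> r / 2" for z unfolding sphere_def by blast
    \<comment> \<open>On an empty sphere any level above \<open>lyap err_bar\<close> is a
      barrier.\<close>
    then show thesis using that[of "r / 2" "lyap err_bar + 1"] \<open>0 < r\<close> by simp
  next
    case False
    then obtain z where "z \<in> ?S" and min: "\<forall>y\<in>?S. lyap z \<le> lyap y"
      using continuous_attains_inf[OF compact_sphere False continuous_lyap] by blast
    then have "dist err_bar z = r / 2" by simp
    then have "lyap err_bar < lyap z" using \<open>0 < r\<close> by (intro r) auto
    then show thesis using that[of "r / 2" "lyap z"] \<open>0 < r\<close> min by simp
  qed
qed

end

subsection \<open>Bounded trajectories\<close>

text \<open>Convergence is studied for any error trajectory that stays in a compact set, separately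
  from the argument that confines it. The types \<open>'a\<close>, \<open>'b\<close>,
  \<open>'c\<close> index edges, nodes and exosystem states.\<close>

locale bounded_error_trajectory = controlled_network +
  fixes z :: "real \<Rightarrow> ('a, 'b, 'c) errstate" and K :: "('a, 'b, 'c) errstate set"
  assumes z: "\<And>t. 0 \<le> t \<Longrightarrow> (z has_vector_derivative err_field (z t)) (at t within {0..})"
    and compact: "compact K" and K: "\<And>t. 0 \<le> t \<Longrightarrow> z t \<in> K"
begin

text \<open>The error field is bounded on the compact set, so the trajectory is Lipschitz.\<close>

lemma z_uniformly_continuous: "uniformly_continuous_on {0..} z"
proof -
  obtain C where C: "\<And>y. y \<in> K \<Longrightarrow> norm (err_field y) \<le> C"
    using compact_imp_bounded[OF compact_continuous_image[OF continuous_err_field compact]]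
    by (auto simp: bounded_iff)
  have "C-lipschitz_on {0..} z"
  proof (rule bounded_derivative_imp_lipschitz)
    show "convex {0::real..}" by simp
    show "0 \<le> C" using norm_ge_zero C[OF K[of 0]] by (rule order_trans) simp
  next
    fix t :: real assume "t \<in> {0..}"
    then show "(z has_derivative (\<lambda>h. h *\<^sub>R err_field (z t))) (at t within {0..})"
      using z by (simp add: has_vector_derivative_def)
    show "onorm (\<lambda>h. h *\<^sub>R err_field (z t)) \<le> C"
    proof (rule onorm_le)
      fix h :: real
      show "norm (h *\<^sub>R err_field (z t)) \<le> C * norm h"
        using mult_left_mono[OF C[OF K[of t]], of "\<bar>h\<bar>"] \<open>t \<in> {0..}\<close> by (simp add: mult.commute)
    qed
  qed
  then show ?thesis by (rule lipschitz_on_uniformly_continuous)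
qed

lemma along_uniformly_continuous:
  fixes g :: "('a, 'b, 'c) errstate \<Rightarrow> real"
  assumes "continuous_on K g"
  shows "uniformly_continuous_on {0..} (\<lambda>t. g (z t))"
proof -
  have "uniformly_continuous_on (z ` {0..}) g"
    by (rule uniformly_continuous_on_subset[OF compact_uniformly_continuous[OF assms compact]])
       (use K in auto)
  then show ?thesis using uniformly_continuous_on_compose[OF z_uniformly_continuous] by blast
qed

lemma dissipation_tendsto: "((\<lambda>t. dissipation (z t)) \<longlongrightarrow> 0) at_top"
proof -
  have "K \<noteq> {}" using K[of 0] by auto
  then obtain y0 where "\<forall>y\<in>K. lyap y0 \<le> lyap y"
    using continuous_attains_inf[OF compact _ continuous_lyap] by blast
  then have lower: "lyap y0 \<le> lyap (z t)" if "0 \<le> t" for t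
    using K that by blast
  obtain L where "((\<lambda>t. lyap (z t)) \<longlongrightarrow> L) at_top"
    using nonincreasing_tendsto_at_top[of "\<lambda>t. lyap (z t)" "lyap y0"] lyap_nonincreasing[of z, OF z] lower
    by metis
  then have "((\<lambda>t. - dissipation (z t)) \<longlongrightarrow> 0) at_top"
  \<comment> \<open>The whole derivative of \<open>lyap\<close> is uniformly continuous along the
    trajectory, so nothing has to be split off.\<close>
  proof (rule barbalat[where a = "\<lambda>t. 0", rotated])
    show "uniformly_continuous_on {0..} (\<lambda>t. - dissipation (z t))"
      by (intro along_uniformly_continuous continuous_on_minus continuous_dissipation)
  qed (simp_all add: lyap_has_derivative z)
  then show ?thesis using tendsto_minus by fastforce
qed

lemma tendsto_0_of_dissipation:
  fixes g :: "('a, 'b, 'c) errstate \<Rightarrow> real"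
  assumes "continuous_on K g" "\<And>y. dissipation y = 0 \<Longrightarrow> g y = 0"
  shows "((\<lambda>t. g (z t)) \<longlongrightarrow> 0) at_top"
  using compact_tendsto_zero_transfer[where z = z and f = dissipation and g = g, OF compact continuous_dissipation assms(1) K dissipation_tendsto] assms(2)
  by blast

section \<open>Vanishing of the frequency, the power imbalance and the oscillator outputs\<close>

lemma w_tendsto: "((\<lambda>t. w_of (z t) $ i) \<longlongrightarrow> 0) at_top"
proof (rule tendsto_0_of_dissipation)
  show "continuous_on K (\<lambda>y. w_of y $ i)" by (intro continuous_intros)
qed (simp add: dissipation_eq_0D(1))

text \<open>Differentiating a linear output of the oscillator error applies \<open>S2\<close> once,
  up to a term proportional to \<omega>, which tends to zero.\<close>

lemma e_functional_has_derivative: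
  assumes "bounded_linear l" "0 \<le> t"
  shows "((\<lambda>t. l (e_of (z t) $ i)) has_real_derivative
    l (S2 *v (e_of (z t) $ i)) - w_of (z t) $ i / q i * l R2) (at t within {0..})"
proof -
  interpret l: bounded_linear l by fact
  have "((\<lambda>t. e_of (z t) $ i) has_vector_derivative e_of (err_field (z t)) $ i) (at t within {0..})"
    by (intro has_vector_derivative_vec_nth has_vector_derivative_snd z assms)
  from l.has_vector_derivative[OF this] show ?thesis
    unfolding has_real_derivative_iff_has_vector_derivative
    by (simp add: err_field_def l.diff l.scaleR)
qed

lemma imbalance_tendsto:
  "((\<lambda>t. ctrl_u q R2 (p_of (z t)) (e_of (z t)) $ i - flow_err (eta_of (z t)) (V_of (z t)) $ i) \<longlongrightarrow> 0) at_top"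
\<comment> \<open>The momentum tends to zero; in its rate the damping term is the part already known
  to vanish, and the imbalance is the part to be identified.\<close>
proof (rule barbalat[where f = "\<lambda>t. Mi i * w_of (z t) $ i" and a = "\<lambda>t. - Ai i * w_of (z t) $ i" and L = 0])
  fix t :: real assume "0 \<le> t"
  have "Mi i \<noteq> 0" using MAT_pos by (metis less_irrefl)
  then show "((\<lambda>t. Mi i * w_of (z t) $ i) has_real_derivative - Ai i * w_of (z t) $ i +
      (ctrl_u q R2 (p_of (z t)) (e_of (z t)) $ i - flow_err (eta_of (z t)) (V_of (z t)) $ i)) (at t within {0..})"
    by (auto intro!: derivative_eq_intros w_has_derivative[OF z[OF \<open>0 \<le> t\<close>]] simp: err_field_def)
next
  show "uniformly_continuous_on {0..} (\<lambda>t. ctrl_u q R2 (p_of (z t)) (e_of (z t)) $ i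
      - flow_err (eta_of (z t)) (V_of (z t)) $ i)"
    by (rule along_uniformly_continuous) (intro continuous_intros)
qed (use tendsto_mult_right_zero[OF w_tendsto, of "- Ai i" i]
    tendsto_mult_right_zero[OF w_tendsto, of "Mi i" i] in auto)

text \<open>The rate of the power on an edge along the error field, by the product rule. Each term
  contains a voltage or angle velocity, hence vanishes where the dissipation does.\<close>

definition line_rate :: "('a, 'b, 'c) errstate \<Rightarrow> 'a \<Rightarrow> real" where
  "line_rate y k =
     B k * (V_of (err_field y) $ ep k * V_of y $ en k + V_of y $ ep k * V_of (err_field y) $ en k) * sin (eta_of y $ k)
     + B k * V_of y $ ep k * V_of y $ en k * cos (eta_of y $ k) * eta_of (err_field y) $ k"

lemma flow_err_has_derivative:
  assumes "0 \<le> t"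
  shows "((\<lambda>t. flow_err (eta_of (z t)) (V_of (z t)) $ i) has_real_derivative
    (\<Sum>k\<in>UNIV. incidence ep en $ i $ k * line_rate (z t) k)) (at t within {0..})"
  unfolding flow_err_def line_err_def Gam_def matrix_vector_mult_def vec_lambda_beta
  by (rule derivative_eq_intros eta_has_derivative V_has_derivative z assms refl | simp)+
     (simp add: line_rate_def algebra_simps)

text \<open>In the rate of the power imbalance every term except the one with
  \<open>R2 \<bullet> (S2 *v e)\<close> vanishes with the dissipation. The terms collected in
  \<open>?a\<close> come from the consensus dynamics, the frequency feedthrough and the line
  flows.\<close>

lemma oscillator_output_rate_tendsto: "((\<lambda>t. R2 \<bullet> (S2 *v (e_of (z t) $ i))) \<longlongrightarrow> 0) at_top"
proof -
  let ?a = "\<lambda>y. p_of (err_field y) $ i / q i - w_of y $ i / q i * (R2 \<bullet> R2) / q i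
     - (\<Sum>k\<in>UNIV. incidence ep en $ i $ k * line_rate y k)"
  have q: "q i \<noteq> 0" using q_pos by (metis less_irrefl)
  have "((\<lambda>t. (R2 \<bullet> (S2 *v (e_of (z t) $ i))) / q i) \<longlongrightarrow> 0) at_top"
  proof (rule barbalat[OF _ imbalance_tendsto, where a = "\<lambda>t. ?a (z t)"])
    fix t :: real assume "0 \<le> t"
    show "((\<lambda>t. ctrl_u q R2 (p_of (z t)) (e_of (z t)) $ i - flow_err (eta_of (z t)) (V_of (z t)) $ i)
        has_real_derivative ?a (z t) + (R2 \<bullet> (S2 *v (e_of (z t) $ i))) / q i) (at t within {0..})"
      unfolding ctrl_u_def vec_lambda_beta
      by (rule derivative_eq_intros flow_err_has_derivative p_has_derivative z
          e_functional_has_derivative bounded_linear_inner_right \<open>0 \<le> t\<close> q refl | simp)+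
         (simp add: q field_simps)
  next
    show "((\<lambda>t. ?a (z t)) \<longlongrightarrow> 0) at_top"
    proof (rule tendsto_0_of_dissipation)
      show "continuous_on K ?a"
        unfolding line_rate_def using q
        by (intro continuous_intros continuous_err_field) auto
      show "?a y = 0" if "dissipation y = 0" for y
      proof -
        have "(\<Sum>j\<in>{j. Gc i j}. p_of y $ j - p_of y $ i) = 0"
        proof (rule sum.neutral, rule ballI)
          fix j show "p_of y $ j - p_of y $ i = 0"
            using dissipation_eq_0D(3)[OF that, of j i] by simp
        qed
        then show ?thesis
          by (simp add: dissipation_eq_0D(1,2)[OF that] line_rate_def err_field_def)
      qed
    qed
  next
    show "uniformly_continuous_on {0..} (\<lambda>t. (R2 \<bullet> (S2 *v (e_of (z t) $ i))) / q i)"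
      by (rule along_uniformly_continuous) (use q in \<open>intro continuous_intros; simp\<close>)
  qed
  from tendsto_mult_right_zero[OF this, of "q i"] show ?thesis by (simp add: q)
qed

text \<open>Each further use of Barbalat's lemma passes from one output to the next power of
  \<open>S2\<close>, the \<omega> term being negligible.\<close>

lemma oscillator_outputs_tendsto:
  "((\<lambda>t. R2 \<bullet> (((*v) S2 ^^ Suc k) (e_of (z t) $ i))) \<longlongrightarrow> 0) at_top"
proof (induction k)
  case 0
  then show ?case using oscillator_output_rate_tendsto by simp
next
  case (Suc k)
  let ?l = "\<lambda>v. R2 \<bullet> (((*v) S2 ^^ Suc k) v)"
  show ?case
  proof (rule barbalat[OF _ Suc, where a = "\<lambda>t. - (w_of (z t) $ i / q i * ?l R2)"])
    fix t :: real assume "0 \<le> t"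
    show "((\<lambda>t. ?l (e_of (z t) $ i)) has_real_derivative - (w_of (z t) $ i / q i * ?l R2)
        + R2 \<bullet> (((*v) S2 ^^ Suc (Suc k)) (e_of (z t) $ i))) (at t within {0..})"
      using e_functional_has_derivative[OF bounded_linear_output[of "Suc k"] \<open>0 \<le> t\<close>, of i]
      by (simp add: funpow_swap1)
  next
    show "((\<lambda>t. - (w_of (z t) $ i / q i * ?l R2)) \<longlongrightarrow> 0) at_top"
      using tendsto_mult_right_zero[OF w_tendsto, of "- (?l R2 / q i)" i] by (simp add: mult.commute)
  next
    show "uniformly_continuous_on {0..} (\<lambda>t. R2 \<bullet> (((*v) S2 ^^ Suc (Suc k)) (e_of (z t) $ i)))"
      by (rule along_uniformly_continuous) (intro continuous_intros)
  qed
qed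

lemma residual_tendsto: "((\<lambda>t. residual (z t)) \<longlongrightarrow> 0) at_top"
proof -
  have "((\<lambda>t. residual (z t)) \<longlongrightarrow> 0 + (\<Sum>i\<in>(UNIV :: 'b set). 0\<^sup>2)
      + (\<Sum>i\<in>(UNIV :: 'b set). \<Sum>k<CARD('c). 0\<^sup>2)) at_top"
    unfolding residual_def
    by (intro tendsto_add tendsto_sum tendsto_power
        dissipation_tendsto imbalance_tendsto oscillator_outputs_tendsto)
  then show ?thesis by simp
qed

lemma tendsto_0_of_residual:
  fixes g :: "('a, 'b, 'c) errstate \<Rightarrow> real"
  assumes "continuous_on K g" "\<And>y. residual y = 0 \<Longrightarrow> g y = 0"
  shows "((\<lambda>t. g (z t)) \<longlongrightarrow> 0) at_top"
  using compact_tendsto_zero_transfer[where z = z and f = residual and g = g, OF compact continuous_residual assms(1) K residual_tendsto] assms(2)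
  by blast

text \<open>The distance to the zero set of \<open>residual\<close> is continuous and vanishes on
  that set, so it tends to zero together with \<open>residual\<close>.\<close>

lemma converges_to_equilibria:
  assumes "0 < \<epsilon>"
  shows "\<forall>\<^sub>F t in at_top. \<exists>y. residual y = 0 \<and> dist (z t) y < \<epsilon>"
proof -
  let ?Z = "{y. residual y = 0}"
  have "((\<lambda>t. infdist (z t) ?Z) \<longlongrightarrow> 0) at_top"
    by (rule tendsto_0_of_residual) (intro continuous_on_infdist continuous_on_id, simp)
  then have "\<forall>\<^sub>F t in at_top. dist (infdist (z t) ?Z) 0 < \<epsilon>" using assms by (rule tendstoD)
  then show ?thesis
  proof eventually_elim
    case (elim t)
    moreover have "?Z \<noteq> {}" using residual_err_bar by blast
    ultimately have "Inf (dist (z t) ` ?Z) < \<epsilon>" by (simp add: infdist_notempty infdist_nonneg)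
    then have "\<exists>d\<in>dist (z t) ` ?Z. d < \<epsilon>"
      using cInf_lessD[of "dist (z t) ` ?Z"] \<open>?Z \<noteq> {}\<close> by blast
    then show ?case by blast
  qed
qed

end

section \<open>Local convergence of the closed loop in the original coordinates\<close>

theorem theorem3:
  fixes ep en :: "'m::finite \<Rightarrow> 'n::finite"
    and B :: "'m \<Rightarrow> real" and Bs Xd Xdp Mi Ai Ti q pi1 :: "'n \<Rightarrow> real"
    and Efd :: "real^'n" and s1 :: "real^'n"
    and S2 :: "real^'p::finite^'p" and R2 :: "real^'p"
    and s2 :: "real \<Rightarrow> real^'p"
    and Gc :: "'n \<Rightarrow> 'n \<Rightarrow> bool"
    and etabar :: "real^'m" and Vbar :: "real^'n"
  assumes graph: "simple_connected_graph ep en"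
    and B_pos: "\<forall>k. B k > 0"
    and Bs_neg: "\<forall>i. Bs i < 0"
    and Bs_dom: "\<forall>i. \<bar>Bs i\<bar> > (\<Sum>k\<in>{k. ep k = i \<or> en k = i}. \<bar>B k\<bar>)"
    and Xd: "\<forall>i. Xd i > Xdp i \<and> Xdp i > 0"
    and MAT_pos: "\<forall>i. Mi i > 0 \<and> Ai i > 0 \<and> Ti i > 0"
    and q_pos: "\<forall>i. q i > 0"
    and S2_skew: "transpose S2 = - S2"
    and S2_nonsing: "\<not> (\<exists>v. v \<noteq> 0 \<and> S2 *v v = 0)"
    and obs: "observable R2 S2"
    and exo: "\<forall>t. (s2 has_vector_derivative (S2 *v s2 t)) (at t)"
    and eta_range: "etabar \<in> range (\<lambda>x. transpose (incidence ep en) *v x)"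
    and eta_box: "\<forall>k. - (pi / 2) < etabar $ k \<and> etabar $ k < pi / 2"
    and V_pos: "\<forall>i. Vbar $ i > 0"
    and equil_flow: "\<forall>t. ubar q (demand q pi1 s1 R2 (s2 t)) - demand q pi1 s1 R2 (s2 t)
                        = incidence ep en *v (\<chi> k. Gam ep en B Vbar $ k * sin (etabar $ k))"
    and equil_volt: "Emat ep en B Bs Xd Xdp etabar *v Vbar = Efd"
    and star: "cond_star ep en B Bs Xd Xdp etabar Vbar"
    and comm: "connected_undirected Gc"
  shows "\<exists>U. open U \<and> (etabar, 0, Vbar, theta1bar q pi1 s1, (\<chi> i. s2 0)) \<in> U \<and>
    (\<forall>x :: real \<Rightarrow> (real^'m) \<times> (real^'n) \<times> (real^'n) \<times> (real^'n) \<times> (real^'p^'n).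
       x 0 \<in> U \<and>
       (\<forall>t\<ge>0. ((\<lambda>t. (x t, s2 t)) has_vector_derivative
                  clfield ep en B Bs Xd Xdp Mi Ai Ti Efd q pi1 s1 S2 R2 Gc (x t, s2 t))
                (at t within {0..}))
     \<longrightarrow>
       converges_to_set (\<lambda>t. (x t, s2 t))
         (largest_invariant_subset (clfield ep en B Bs Xd Xdp Mi Ai Ti Efd q pi1 s1 S2 R2 Gc)
           {((eta, w, V, th1, th2), s). w = 0 \<and> Emat ep en B Bs Xd Xdp eta *v V - Efd = 0 \<and>
              th1 = theta1bar q pi1 s1 \<and> th2 = (\<chi> i. s)})
       \<and> ((\<lambda>t. fst (snd (x t))) \<longlongrightarrow> 0) at_top
       \<and> ((\<lambda>t. ctrl_u q R2 (fst (snd (snd (snd (x t))))) (snd (snd (snd (snd (x t)))))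
               - ubar q (demand q pi1 s1 R2 (s2 t))) \<longlongrightarrow> 0) at_top)"
proof -
  interpret controlled_network ep en B Bs Xd Xdp Mi Ai Ti q pi1 Efd s1 S2 R2 s2 Gc etabar Vbar
    by unfold_locales fact+
  obtain r m where "0 < r" and m: "lyap err_bar < m" "\<And>z. dist err_bar z = r \<Longrightarrow> m \<le> lyap z"
    using attraction_region by blast
  \<comment> \<open>The ball starts the trajectory inside the sphere; the sublevel set keeps
    \<open>lyap\<close> below the barrier for all later times.\<close>
  let ?N = "{z. dist err_bar z < r} \<inter> {z. lyap z < m}"
  let ?U = "(\<lambda>x. x - operating_ctrl 0) -` ?N"
  let ?target = "largest_invariant_subset (clfield ep en B Bs Xd Xdp Mi Ai Ti Efd q pi1 s1 S2 R2 Gc)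
           {((eta, w, V, th1, th2), s). w = 0 \<and> Emat ep en B Bs Xd Xdp eta *v V - Efd = 0 \<and>
              th1 = theta1bar q pi1 s1 \<and> th2 = (\<chi> i. s)}"
  have "open ?N"
    by (intro open_Int open_Collect_less continuous_lyap continuous_intros)
  then have "open ?U" by (intro open_vimage continuous_intros)
  moreover have "(etabar, 0, Vbar, theta1bar q pi1 s1, (\<chi> i. s2 0)) \<in> ?U"
    using \<open>0 < r\<close> m(1) by (simp add: operating_ctrl_def err_bar_def zero_prod_def)
  moreover have "converges_to_set (\<lambda>t. (x t, s2 t)) ?target
       \<and> ((\<lambda>t. fst (snd (x t))) \<longlongrightarrow> 0) at_top
       \<and> ((\<lambda>t. ctrl_u q R2 (fst (snd (snd (snd (x t))))) (snd (snd (snd (snd (x t)))))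
               - ubar q (demand q pi1 s1 R2 (s2 t))) \<longlongrightarrow> 0) at_top"
    if "x 0 \<in> ?U" and sol: "\<forall>t\<ge>0. ((\<lambda>t. (x t, s2 t)) has_vector_derivative
                  clfield ep en B Bs Xd Xdp Mi Ai Ti Efd q pi1 s1 S2 R2 Gc (x t, s2 t))
                (at t within {0..})"
    for x :: "real \<Rightarrow> (real^'m) \<times> (real^'n) \<times> (real^'n) \<times> (real^'n) \<times> (real^'p^'n)"
  proof -
    define z where "z t = x t - operating_ctrl t" for t
    have x: "x t = z t + operating_ctrl t" for t by (simp add: z_def)
    have z: "(z has_vector_derivative err_field (z t)) (at t within {0..})" if "0 \<le> t" for t
    proof -
      have "(x has_vector_derivative err_field (z t) + (0, 0, 0, 0, \<chi> i. S2 *v s2 t)) (at t within {0..})"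
        using has_vector_derivative_fst[OF sol[rule_format, OF that]]
        by (simp add: x[of t] net_field_eq)
      from has_vector_derivative_diff[OF this operating_ctrl_has_derivative] show ?thesis
        by (simp add: z_def[abs_def])
    qed
    have start: "dist err_bar (z 0) < r" "lyap (z 0) < m" using that(1) by (simp_all add: z_def)
    have "continuous_on {0..} z"
      by (rule continuous_on_vector_derivative) (use z in auto)
    then have "dist err_bar (z t) < r" if "0 \<le> t" for t
      using confined_to_ball[of z err_bar r m lyap t] start m(2) that
        lyap_nonincreasing[of z, OF z, of 0] by fastforce
    then interpret bounded_error_trajectory ep en B Bs Xd Xdp Mi Ai Ti q pi1 Efd s1 S2 R2 s2 Gc
        etabar Vbar z "cball err_bar r"
      by unfold_locales (auto simp: z less_imp_le)
    have "converges_to_set (\<lambda>t. (x t, s2 t)) ?target"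
      unfolding converges_to_set_def
    proof (intro allI impI)
      fix \<epsilon> :: real assume "0 < \<epsilon>"
      show "\<forall>\<^sub>F t in at_top. \<exists>y\<in>?target. dist (x t, s2 t) y < \<epsilon>"
        using converges_to_equilibria[OF \<open>0 < \<epsilon>\<close>]
      proof eventually_elim
        case (elim t)
        then obtain y where "residual y = 0" and y: "dist (z t) y < \<epsilon>" by blast
        \<comment> \<open>The equilibrium is paired with the current reference and exosystem state,
          so only the error distance remains.\<close>
        moreover have "dist (x t, s2 t) (y + operating_ctrl t, s2 t) < \<epsilon>"
          using y by (simp add: x dist_Pair_Pair)
        ultimately show ?case using equilibria_in_largest_invariant_subset by blast
      qed
    qed
    moreover have "((\<lambda>t. fst (snd (x t))) \<longlongrightarrow> 0) at_top"
      by (rule vec_tendstoI) (use w_tendsto in \<open>simp add: x operating_ctrl_def\<close>)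
    moreover have "((\<lambda>t. ctrl_u q R2 (fst (snd (snd (snd (x t))))) (snd (snd (snd (snd (x t)))))
               - ubar q (demand q pi1 s1 R2 (s2 t))) \<longlongrightarrow> 0) at_top"
    proof (rule vec_tendstoI)
      fix i
      have "((\<lambda>t. ctrl_u q R2 (fst (snd (snd (snd (z t))))) (snd (snd (snd (snd (z t))))) $ i) \<longlongrightarrow> 0) at_top"
        by (rule tendsto_0_of_residual) (intro continuous_intros, simp add: residual_eq_0D ctrl_u_def)
      then show "((\<lambda>t. (ctrl_u q R2 (fst (snd (snd (snd (x t))))) (snd (snd (snd (snd (x t)))))
               - ubar q (demand q pi1 s1 R2 (s2 t))) $ i) \<longlongrightarrow> 0 $ i) at_top"
        by (simp add: x operating_ctrl_def ubar_eq ctrl_u_add)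
    qed
    ultimately show ?thesis by blast
  qed
  ultimately show ?thesis by blast
qed

end
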